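(* Let $T$ be a right Hopf monad on a right autonomous category $\mathcal{C}$. Suppose that right Hopf $T$-modules admit coinvariants which are preserved by $T$. Then the assignments $$X\mapsto\bigl(T(X),\mu_X,T_2(X,\mathbf 1)\bigr),\qquad f\mapsto T(f)$$ define a functor from $\mathcal{C}$ to the category of right Hopf $T$-modules, which is an equivalence of categories if and only if $T$ is conservative.
   Context: Conventions: categories are small, monoidal categories $(\mathcal{C},\otimes,\mathbf 1)$ are strict; composition of $f$ followed by $g$ is written $gf$; "functorial" means natural. A functor $F$ is conservative if any morphism $f$ such that $F(f)$ is an isomorphism is itself an isomorphism. Monads: a monad on $\mathcal{C}$ is $(T,\mu\colon T^2\to T,\eta\colon 1_{\mathcal C}\to T)$ with $\mu_XT(\mu_X)=\mu_X\mu_{T(X)}$, $\mu_X\eta_{T(X)}=\mathrm{id}=\mu_XT(\eta_X)$. A $T$-module is $(M,r)$ with $r\colon T(M)\to M$, $rT(r)=r\mu_M$, $r\eta_M=\mathrm{id}_M$; a $T$-linear morphism $f\colon(M,r)\to(N,s)$ satisfies $fr=sT(f)$. Bimonads: a bimonad on a monoidal category $\mathcal{C}$ is a monad $T$ equipped with natural $T_2(X,Y)\colon T(X\otimes Y)\to T(X)\otimes T(Y)$ and $T_0\colon T(\mathbf 1)\to\mathbf 1$ with $(\mathrm{id}\otimes T_2(Y,Z))T_2(X,Y\otimes Z)=(T_2(X,Y)\otimes \mathrm{id})T_2(X\otimes Y,Z)$, $(\mathrm{id}\otimes T_0)T_2(X,\mathbf 1)=\mathrm{id}=(T_0\otimes\mathrm{id})T_2(\mathbf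 1,X)$, $T_2(X,Y)\mu_{X\otimes Y}=(\mu_X\otimes\mu_Y)T_2(T(X),T(Y))T(T_2(X,Y))$, $T_0\mu_{\mathbf 1}=T_0T(T_0)$, $T_2(X,Y)\eta_{X\otimes Y}=\eta_X\otimes\eta_Y$, $T_0\eta_{\mathbf 1}=\mathrm{id}_{\mathbf 1}$. Right Hopf monads: $\mathcal{C}$ is right autonomous if each object $X$ has a (chosen) right dual $(X^\vee,\widetilde{\mathrm{ev}}_X\colon X\otimes X^\vee\to\mathbf 1,\widetilde{\mathrm{coev}}_X\colon\mathbf 1\to X^\vee\otimes X)$. A right Hopf monad is a bimonad $T$ on a right autonomous category admitting a right antipode, i.e. a functorial family $s^r_X\colon T(T(X)^\vee)\to X^\vee$ such that for all $X$: $T_0T(\widetilde{\mathrm{ev}}_X)T(\mathrm{id}_X\otimes\eta_X^\vee)=\widetilde{\mathrm{ev}}_{T(X)}(\mathrm{id}_{T(X)}\otimes s^r_{T(X)}T(\mu_X^\vee))T_2(X,T(X)^\vee)$ and $(\mathrm{id}_{X^\vee}\otimes\eta_X)\widetilde{\mathrm{coev}}_XT_0=(s^r_X\otimes\mu_X)T_2(T(X)^\vee,T(X))T(\widetilde{\mathrm{coev}}_{T(X)})$. Hopf modules: $T(\mathbf 1)$ is a coalgebra in $\mathcal{C}$ with coproduct $T_2(\mathbf 1,\mathbf 1)$ and counit $T_0$; a right $T$-comodule is a right $T(\mathbf 1)$-comodule $(M,\rho\colon M\to M\otimes T(\mathbf 1))$. A right Hopf $T$-module is a triple $(M,r,\rho)$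 with $(M,r)$ a $T$-module, $(M,\rho)$ a right $T$-comodule and $\rho r=(r\otimes\mu_{\mathbf 1})T_2(M,T(\mathbf 1))T(\rho)$. A morphism of right Hopf $T$-modules is a $T$-linear morphism that is also a morphism of right $T$-comodules. Coinvariants: a right Hopf $T$-module $(M,r,\rho)$ admits coinvariants if the pair $\rho,\ \mathrm{id}_M\otimes\eta_{\mathbf 1}\colon M\to M\otimes T(\mathbf 1)$ has an equalizer $i\colon M^{\mathrm{co}T}\to M$; the coinvariants are preserved by $T$ if $T(i)$ is an equalizer of $T(\rho),\ T(\mathrm{id}_M\otimes\eta_{\mathbf 1})$. *)

theory Defs
  imports Main
begin

(* Every axiom is relativised to the carriers Obj and Arr; the values of the operations
   outside them (for instance on non-composable pairs) are irrelevant.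
   Comp C g f, written g \<cdot> f, is f followed by g. *)

record ('o, 'm) category =
  Obj :: "'o set"
  Arr :: "'m set"
  Dom :: "'m \<Rightarrow> 'o"
  Cod :: "'m \<Rightarrow> 'o"
  Ident :: "'o \<Rightarrow> 'm"
  Comp :: "'m \<Rightarrow> 'm \<Rightarrow> 'm" (infixl "\<cdot>\<index>" 65)

definition hom :: "('o, 'm, 'x) category_scheme \<Rightarrow> 'o \<Rightarrow> 'o \<Rightarrow> 'm set" where
  "hom C X Y = {f \<in> Arr C. Dom C f = X \<and> Cod C f = Y}"

locale category =
  fixes C :: "('o, 'm, 'x) category_scheme" (structure)
  assumes dom_obj: "f \<in> Arr C \<Longrightarrow> Dom C f \<in> Obj C"
    and cod_obj: "f \<in> Arr C \<Longrightarrow> Cod C f \<in> Obj C"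
    and ident_hom: "X \<in> Obj C \<Longrightarrow> Ident C X \<in> hom C X X"
    and comp_hom: "f \<in> hom C X Y \<Longrightarrow> g \<in> hom C Y Z \<Longrightarrow> g \<cdot> f \<in> hom C X Z"
    and comp_ident: "f \<in> hom C X Y \<Longrightarrow> f \<cdot> Ident C X = f"
    and ident_comp: "f \<in> hom C X Y \<Longrightarrow> Ident C Y \<cdot> f = f"
    and comp_assoc: "f \<in> hom C W X \<Longrightarrow> g \<in> hom C X Y \<Longrightarrow> h \<in> hom C Y Z
      \<Longrightarrow> h \<cdot> (g \<cdot> f) = (h \<cdot> g) \<cdot> f"

definition is_iso :: "('o, 'm, 'x) category_scheme \<Rightarrow> 'm \<Rightarrow> bool" where
  "is_iso C f \<longleftrightarrow> f \<in> Arr C \<and>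
     (\<exists>g \<in> hom C (Cod C f) (Dom C f).
        g \<cdot>\<^bsub>C\<^esub> f = Ident C (Dom C f) \<and> f \<cdot>\<^bsub>C\<^esub> g = Ident C (Cod C f))"

definition is_equalizer :: "('o, 'm, 'x) category_scheme \<Rightarrow> 'm \<Rightarrow> 'm \<Rightarrow> 'm \<Rightarrow> bool" where
  "is_equalizer C f g i \<longleftrightarrow>
     f \<in> Arr C \<and> g \<in> hom C (Dom C f) (Cod C f) \<and>
     i \<in> Arr C \<and> Cod C i = Dom C f \<and> f \<cdot>\<^bsub>C\<^esub> i = g \<cdot>\<^bsub>C\<^esub> i \<and>
     (\<forall>h \<in> Arr C. Cod C h = Dom C f \<longrightarrow> f \<cdot>\<^bsub>C\<^esub> h = g \<cdot>\<^bsub>C\<^esub> h \<longrightarrow>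
        (\<exists>!k. k \<in> hom C (Dom C h) (Dom C i) \<and> i \<cdot>\<^bsub>C\<^esub> k = h))"


record ('o, 'm, 'p, 'n) functor_data =
  FObj :: "'o \<Rightarrow> 'p"
  FArr :: "'m \<Rightarrow> 'n"

locale cat_functor = C: category C + D: category D
  for C :: "('o, 'm, 'x) category_scheme" and D :: "('p, 'n, 'y) category_scheme" +
  fixes F :: "('o, 'm, 'p, 'n, 'z) functor_data_scheme"
  assumes map_obj: "X \<in> Obj C \<Longrightarrow> FObj F X \<in> Obj D"
    and map_hom: "f \<in> hom C X Y \<Longrightarrow> FArr F f \<in> hom D (FObj F X) (FObj F Y)"
    and map_ident: "X \<in> Obj C \<Longrightarrow> FArr F (Ident C X) = Ident D (FObj F X)"
    and map_comp: "f \<in> hom C X Y \<Longrightarrow> g \<in> hom C Y Z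
      \<Longrightarrow> FArr F (g \<cdot>\<^bsub>C\<^esub> f) = FArr F g \<cdot>\<^bsub>D\<^esub> FArr F f"

definition id_functor :: "('o, 'm, 'o, 'm) functor_data" where
  "id_functor = \<lparr>FObj = (\<lambda>X. X), FArr = (\<lambda>f. f)\<rparr>"

definition comp_functor :: "('p, 'n, 'q, 'k, 'y) functor_data_scheme
    \<Rightarrow> ('o, 'm, 'p, 'n, 'z) functor_data_scheme \<Rightarrow> ('o, 'm, 'q, 'k) functor_data" where
  "comp_functor G F = \<lparr>FObj = (\<lambda>X. FObj G (FObj F X)), FArr = (\<lambda>f. FArr G (FArr F f))\<rparr>"

locale nat_trans = F: cat_functor C D F + G: cat_functor C D G
  for C :: "('o, 'm, 'x) category_scheme" and D :: "('p, 'n, 'y) category_scheme"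
    and F :: "('o, 'm, 'p, 'n, 'z) functor_data_scheme"
    and G :: "('o, 'm, 'p, 'n, 'w) functor_data_scheme" +
  fixes \<alpha> :: "'o \<Rightarrow> 'n"
  assumes component_hom: "X \<in> Obj C \<Longrightarrow> \<alpha> X \<in> hom D (FObj F X) (FObj G X)"
    and natural: "f \<in> hom C X Y \<Longrightarrow> \<alpha> Y \<cdot>\<^bsub>D\<^esub> FArr F f = FArr G f \<cdot>\<^bsub>D\<^esub> \<alpha> X"

definition nat_iso where
  "nat_iso C D F G \<alpha> \<longleftrightarrow> nat_trans C D F G \<alpha> \<and> (\<forall>X \<in> Obj C. is_iso D (\<alpha> X))"

definition is_equivalence :: "('o, 'm, 'x) category_scheme \<Rightarrow> ('p, 'n, 'y) category_scheme
    \<Rightarrow> ('o, 'm, 'p, 'n, 'z) functor_data_scheme \<Rightarrow> bool" where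
  "is_equivalence C D F \<longleftrightarrow> cat_functor C D F \<and>
     (\<exists>G :: ('p, 'n, 'o, 'm) functor_data. cat_functor D C G \<and>
        (\<exists>\<alpha>. nat_iso C C id_functor (comp_functor G F) \<alpha>) \<and>
        (\<exists>\<beta>. nat_iso D D (comp_functor F G) id_functor \<beta>))"

definition conservative :: "('o, 'm, 'x) category_scheme \<Rightarrow> ('p, 'n, 'y) category_scheme
    \<Rightarrow> ('o, 'm, 'p, 'n, 'z) functor_data_scheme \<Rightarrow> bool" where
  "conservative C D F \<longleftrightarrow> (\<forall>f \<in> Arr C. is_iso D (FArr F f) \<longrightarrow> is_iso C f)"


record ('o, 'm) monoidal_category = "('o, 'm) category" +
  Unit :: "'o" ("\<one>\<index>")
  TenObj :: "'o \<Rightarrow> 'o \<Rightarrow> 'o" (infixl "\<odot>\<index>" 70)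
  TenArr :: "'m \<Rightarrow> 'm \<Rightarrow> 'm" (infixl "\<otimes>\<index>" 70)

locale strict_monoidal_category = category C
  for C :: "('o, 'm, 'x) monoidal_category_scheme" (structure) +
  assumes unit_obj: "\<one> \<in> Obj C"
    and ten_obj: "X \<in> Obj C \<Longrightarrow> Y \<in> Obj C \<Longrightarrow> X \<odot> Y \<in> Obj C"
    and ten_hom: "f \<in> hom C X X' \<Longrightarrow> g \<in> hom C Y Y' \<Longrightarrow> f \<otimes> g \<in> hom C (X \<odot> Y) (X' \<odot> Y')"
    and ten_ident: "X \<in> Obj C \<Longrightarrow> Y \<in> Obj C \<Longrightarrow> Ident C X \<otimes> Ident C Y = Ident C (X \<odot> Y)"
    and interchange: "f \<in> hom C X X' \<Longrightarrow> f' \<in> hom C X' X'' \<Longrightarrow> g \<in> hom C Y Y' \<Longrightarrow> g' \<in> hom C Y' Y''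
      \<Longrightarrow> (f' \<cdot> f) \<otimes> (g' \<cdot> g) = (f' \<otimes> g') \<cdot> (f \<otimes> g)"
    and ten_obj_assoc: "X \<in> Obj C \<Longrightarrow> Y \<in> Obj C \<Longrightarrow> Z \<in> Obj C \<Longrightarrow> (X \<odot> Y) \<odot> Z = X \<odot> (Y \<odot> Z)"
    and ten_arr_assoc: "f \<in> Arr C \<Longrightarrow> g \<in> Arr C \<Longrightarrow> h \<in> Arr C \<Longrightarrow> (f \<otimes> g) \<otimes> h = f \<otimes> (g \<otimes> h)"
    and unit_ten_obj: "X \<in> Obj C \<Longrightarrow> \<one> \<odot> X = X"
    and ten_unit_obj: "X \<in> Obj C \<Longrightarrow> X \<odot> \<one> = X"
    and unit_ten_arr: "f \<in> Arr C \<Longrightarrow> Ident C \<one> \<otimes> f = f"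
    and ten_unit_arr: "f \<in> Arr C \<Longrightarrow> f \<otimes> Ident C \<one> = f"

record ('o, 'm) right_autonomous_category = "('o, 'm) monoidal_category" +
  RDual :: "'o \<Rightarrow> 'o"
  REv :: "'o \<Rightarrow> 'm"
  RCoev :: "'o \<Rightarrow> 'm"

locale right_autonomous_category = strict_monoidal_category C
  for C :: "('o, 'm, 'x) right_autonomous_category_scheme" (structure) +
  assumes rdual_obj: "X \<in> Obj C \<Longrightarrow> RDual C X \<in> Obj C"
    and rev_hom: "X \<in> Obj C \<Longrightarrow> REv C X \<in> hom C (X \<odot> RDual C X) \<one>"
    and rcoev_hom: "X \<in> Obj C \<Longrightarrow> RCoev C X \<in> hom C \<one> (RDual C X \<odot> X)"
    and rdual_zigzag1: "X \<in> Obj C \<Longrightarrow>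
      (REv C X \<otimes> Ident C X) \<cdot> (Ident C X \<otimes> RCoev C X) = Ident C X"
    and rdual_zigzag2: "X \<in> Obj C \<Longrightarrow>
      (Ident C (RDual C X) \<otimes> REv C X) \<cdot> (RCoev C X \<otimes> Ident C (RDual C X)) = Ident C (RDual C X)"

(* The dual of f : X \<rightarrow> Y is the composite
   RDual Y \<rightarrow> RDual X \<odot> X \<odot> RDual Y \<rightarrow> RDual X \<odot> Y \<odot> RDual Y \<rightarrow> RDual X. *)
definition rdual_arr :: "('o, 'm, 'x) right_autonomous_category_scheme \<Rightarrow> 'm \<Rightarrow> 'm" where
  "rdual_arr C f =
     (Ident C (RDual C (Dom C f)) \<otimes>\<^bsub>C\<^esub> REv C (Cod C f)) \<cdot>\<^bsub>C\<^esub>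
     (Ident C (RDual C (Dom C f)) \<otimes>\<^bsub>C\<^esub> f \<otimes>\<^bsub>C\<^esub> Ident C (RDual C (Cod C f))) \<cdot>\<^bsub>C\<^esub>
     (RCoev C (Dom C f) \<otimes>\<^bsub>C\<^esub> Ident C (RDual C (Cod C f)))"


record ('o, 'm) monad = "('o, 'm, 'o, 'm) functor_data" +
  Mu :: "'o \<Rightarrow> 'm"
  Eta :: "'o \<Rightarrow> 'm"

locale monad = cat_functor C C T
    + mu: nat_trans C C "comp_functor T T" T "Mu T" + eta: nat_trans C C id_functor T "Eta T"
  for C :: "('o, 'm, 'x) category_scheme" (structure)
    and T :: "('o, 'm, 'z) monad_scheme" +
  assumes mu_assoc: "X \<in> Obj C \<Longrightarrow> Mu T X \<cdot> FArr T (Mu T X) = Mu T X \<cdot> Mu T (FObj T X)"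
    and mu_eta: "X \<in> Obj C \<Longrightarrow> Mu T X \<cdot> Eta T (FObj T X) = Ident C (FObj T X)"
    and mu_map_eta: "X \<in> Obj C \<Longrightarrow> Mu T X \<cdot> FArr T (Eta T X) = Ident C (FObj T X)"

definition is_module :: "('o, 'm, 'x) category_scheme \<Rightarrow> ('o, 'm, 'z) monad_scheme
    \<Rightarrow> 'o \<Rightarrow> 'm \<Rightarrow> bool" where
  "is_module C T M r \<longleftrightarrow> M \<in> Obj C \<and> r \<in> hom C (FObj T M) M \<and>
     r \<cdot>\<^bsub>C\<^esub> FArr T r = r \<cdot>\<^bsub>C\<^esub> Mu T M \<and> r \<cdot>\<^bsub>C\<^esub> Eta T M = Ident C M"

record ('o, 'm) bimonad = "('o, 'm) monad" +
  Cop :: "'o \<Rightarrow> 'o \<Rightarrow> 'm" ("T\<^sub>2\<index>")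
  Cou :: "'m" ("T\<^sub>0\<index>")

locale bimonad = strict_monoidal_category C + monad C T
  for C :: "('o, 'm, 'x) monoidal_category_scheme" (structure)
    and T :: "('o, 'm, 'z) bimonad_scheme" (structure) +
  assumes cop_hom: "X \<in> Obj C \<Longrightarrow> Y \<in> Obj C
      \<Longrightarrow> T\<^sub>2\<^bsub>T\<^esub> X Y \<in> hom C (FObj T (X \<odot> Y)) (FObj T X \<odot> FObj T Y)"
    and cop_natural: "f \<in> hom C X X' \<Longrightarrow> g \<in> hom C Y Y'
      \<Longrightarrow> T\<^sub>2\<^bsub>T\<^esub> X' Y' \<cdot> FArr T (f \<otimes> g) = (FArr T f \<otimes> FArr T g) \<cdot> T\<^sub>2\<^bsub>T\<^esub> X Y"
    and cou_hom: "T\<^sub>0\<^bsub>T\<^esub> \<in> hom C (FObj T \<one>) \<one>"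
    and cop_coassoc: "X \<in> Obj C \<Longrightarrow> Y \<in> Obj C \<Longrightarrow> Z \<in> Obj C
      \<Longrightarrow> (Ident C (FObj T X) \<otimes> T\<^sub>2\<^bsub>T\<^esub> Y Z) \<cdot> T\<^sub>2\<^bsub>T\<^esub> X (Y \<odot> Z)
        = (T\<^sub>2\<^bsub>T\<^esub> X Y \<otimes> Ident C (FObj T Z)) \<cdot> T\<^sub>2\<^bsub>T\<^esub> (X \<odot> Y) Z"
    and cop_counit_right: "X \<in> Obj C
      \<Longrightarrow> (Ident C (FObj T X) \<otimes> T\<^sub>0\<^bsub>T\<^esub>) \<cdot> T\<^sub>2\<^bsub>T\<^esub> X \<one> = Ident C (FObj T X)"
    and cop_counit_left: "X \<in> Obj C
      \<Longrightarrow> (T\<^sub>0\<^bsub>T\<^esub> \<otimes> Ident C (FObj T X)) \<cdot> T\<^sub>2\<^bsub>T\<^esub> \<one> X = Ident C (FObj T X)"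
    and cop_mu: "X \<in> Obj C \<Longrightarrow> Y \<in> Obj C \<Longrightarrow> T\<^sub>2\<^bsub>T\<^esub> X Y \<cdot> Mu T (X \<odot> Y)
        = (Mu T X \<otimes> Mu T Y) \<cdot> T\<^sub>2\<^bsub>T\<^esub> (FObj T X) (FObj T Y) \<cdot> FArr T (T\<^sub>2\<^bsub>T\<^esub> X Y)"
    and cou_mu: "T\<^sub>0\<^bsub>T\<^esub> \<cdot> Mu T \<one> = T\<^sub>0\<^bsub>T\<^esub> \<cdot> FArr T (T\<^sub>0\<^bsub>T\<^esub>)"
    and cop_eta: "X \<in> Obj C \<Longrightarrow> Y \<in> Obj C \<Longrightarrow> T\<^sub>2\<^bsub>T\<^esub> X Y \<cdot> Eta T (X \<odot> Y) = Eta T X \<otimes> Eta T Y"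
    and cou_eta: "T\<^sub>0\<^bsub>T\<^esub> \<cdot> Eta T \<one> = Ident C \<one>"

locale right_antipode = right_autonomous_category C + bimonad C T
  for C :: "('o, 'm, 'x) right_autonomous_category_scheme" (structure)
    and T :: "('o, 'm, 'z) bimonad_scheme" +
  fixes s :: "'o \<Rightarrow> 'm"
  assumes antipode_hom: "X \<in> Obj C
      \<Longrightarrow> s X \<in> hom C (FObj T (RDual C (FObj T X))) (RDual C X)"
    and antipode_natural: "f \<in> hom C X Y
      \<Longrightarrow> s X \<cdot> FArr T (rdual_arr C (FArr T f)) = rdual_arr C f \<cdot> s Y"
    and antipode_ev: "X \<in> Obj C \<Longrightarrow>
      T\<^sub>0\<^bsub>T\<^esub> \<cdot> FArr T (REv C X) \<cdot> FArr T (Ident C X \<otimes> rdual_arr C (Eta T X))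
      = REv C (FObj T X)
        \<cdot> (Ident C (FObj T X) \<otimes> (s (FObj T X) \<cdot> FArr T (rdual_arr C (Mu T X))))
        \<cdot> T\<^sub>2\<^bsub>T\<^esub> X (RDual C (FObj T X))"
    and antipode_coev: "X \<in> Obj C \<Longrightarrow>
      (Ident C (RDual C X) \<otimes> Eta T X) \<cdot> RCoev C X \<cdot> T\<^sub>0\<^bsub>T\<^esub>
      = (s X \<otimes> Mu T X) \<cdot> T\<^sub>2\<^bsub>T\<^esub> (RDual C (FObj T X)) (FObj T X) \<cdot> FArr T (RCoev C (FObj T X))"

definition right_hopf_monad :: "('o, 'm, 'x) right_autonomous_category_scheme
    \<Rightarrow> ('o, 'm, 'z) bimonad_scheme \<Rightarrow> bool" where
  "right_hopf_monad C T \<longleftrightarrow> right_autonomous_category C \<and> bimonad C T \<and> (\<exists>s. right_antipode C T s)"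


(* A right comodule over the coalgebra T(1), whose coproduct is T\<^sub>2(1,1) and whose counit is T\<^sub>0. *)
definition is_right_comodule :: "('o, 'm, 'x) monoidal_category_scheme
    \<Rightarrow> ('o, 'm, 'z) bimonad_scheme \<Rightarrow> 'o \<Rightarrow> 'm \<Rightarrow> bool" where
  "is_right_comodule C T M \<rho> \<longleftrightarrow> M \<in> Obj C \<and> \<rho> \<in> hom C M (M \<odot>\<^bsub>C\<^esub> FObj T \<one>\<^bsub>C\<^esub>) \<and>
     (\<rho> \<otimes>\<^bsub>C\<^esub> Ident C (FObj T \<one>\<^bsub>C\<^esub>)) \<cdot>\<^bsub>C\<^esub> \<rho> = (Ident C M \<otimes>\<^bsub>C\<^esub> T\<^sub>2\<^bsub>T\<^esub> \<one>\<^bsub>C\<^esub> \<one>\<^bsub>C\<^esub>) \<cdot>\<^bsub>C\<^esub> \<rho> \<and>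
     (Ident C M \<otimes>\<^bsub>C\<^esub> T\<^sub>0\<^bsub>T\<^esub>) \<cdot>\<^bsub>C\<^esub> \<rho> = Ident C M"

definition is_right_hopf_module :: "('o, 'm, 'x) monoidal_category_scheme
    \<Rightarrow> ('o, 'm, 'z) bimonad_scheme \<Rightarrow> 'o \<Rightarrow> 'm \<Rightarrow> 'm \<Rightarrow> bool" where
  "is_right_hopf_module C T M r \<rho> \<longleftrightarrow> is_module C T M r \<and> is_right_comodule C T M \<rho> \<and>
     \<rho> \<cdot>\<^bsub>C\<^esub> r = (r \<otimes>\<^bsub>C\<^esub> Mu T \<one>\<^bsub>C\<^esub>) \<cdot>\<^bsub>C\<^esub> T\<^sub>2\<^bsub>T\<^esub> M (FObj T \<one>\<^bsub>C\<^esub>) \<cdot>\<^bsub>C\<^esub> FArr T \<rho>"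

(* f is a morphism (M,r,\<rho>) \<rightarrow> (N,s,\<sigma>): it is T-linear and a morphism of T(1)-comodules. *)
definition is_right_hopf_module_hom :: "('o, 'm, 'x) monoidal_category_scheme
    \<Rightarrow> ('o, 'm, 'z) bimonad_scheme \<Rightarrow> 'o \<times> 'm \<times> 'm \<Rightarrow> 'm \<Rightarrow> 'o \<times> 'm \<times> 'm \<Rightarrow> bool" where
  "is_right_hopf_module_hom C T A f B \<longleftrightarrow> (case (A, B) of ((M, r, \<rho>), (N, s, \<sigma>)) \<Rightarrow>
     f \<in> hom C M N \<and> f \<cdot>\<^bsub>C\<^esub> r = s \<cdot>\<^bsub>C\<^esub> FArr T f \<and>
     \<sigma> \<cdot>\<^bsub>C\<^esub> f = (f \<otimes>\<^bsub>C\<^esub> Ident C (FObj T \<one>\<^bsub>C\<^esub>)) \<cdot>\<^bsub>C\<^esub> \<rho>)"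

(* An arrow carries its source and target, since one arrow of C may underlie
   morphisms between several pairs of Hopf modules. *)
definition right_hopf_modules :: "('o, 'm, 'x) monoidal_category_scheme
    \<Rightarrow> ('o, 'm, 'z) bimonad_scheme
    \<Rightarrow> ('o \<times> 'm \<times> 'm, ('o \<times> 'm \<times> 'm) \<times> 'm \<times> ('o \<times> 'm \<times> 'm)) category" where
  "right_hopf_modules C T =
     \<lparr>Obj = {(M, r, \<rho>). is_right_hopf_module C T M r \<rho>},
      Arr = {(A, f, B). (case A of (M, r, \<rho>) \<Rightarrow> is_right_hopf_module C T M r \<rho>) \<and>
                        (case B of (N, s, \<sigma>) \<Rightarrow> is_right_hopf_module C T N s \<sigma>) \<and>
                        is_right_hopf_module_hom C T A f B},
      Dom = (\<lambda>(A, f, B). A),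
      Cod = (\<lambda>(A, f, B). B),
      Ident = (\<lambda>(M, r, \<rho>). ((M, r, \<rho>), Ident C M, (M, r, \<rho>))),
      Comp = (\<lambda>(A', g, B') (A, f, B). (A, g \<cdot>\<^bsub>C\<^esub> f, B'))\<rparr>"

definition free_hopf_module_functor :: "('o, 'm, 'x) monoidal_category_scheme
    \<Rightarrow> ('o, 'm, 'z) bimonad_scheme
    \<Rightarrow> ('o, 'm, 'o \<times> 'm \<times> 'm, ('o \<times> 'm \<times> 'm) \<times> 'm \<times> ('o \<times> 'm \<times> 'm)) functor_data" where
  "free_hopf_module_functor C T =
     (let H = (\<lambda>X. (FObj T X, Mu T X, T\<^sub>2\<^bsub>T\<^esub> X \<one>\<^bsub>C\<^esub>))
      in \<lparr>FObj = H, FArr = (\<lambda>f. (H (Dom C f), FArr T f, H (Cod C f)))\<rparr>)"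

definition is_coinvariants :: "('o, 'm, 'x) monoidal_category_scheme
    \<Rightarrow> ('o, 'm, 'z) bimonad_scheme \<Rightarrow> 'o \<Rightarrow> 'm \<Rightarrow> 'm \<Rightarrow> bool" where
  "is_coinvariants C T M \<rho> i \<longleftrightarrow> is_equalizer C \<rho> (Ident C M \<otimes>\<^bsub>C\<^esub> Eta T \<one>\<^bsub>C\<^esub>) i"

definition admits_coinvariants :: "('o, 'm, 'x) monoidal_category_scheme
    \<Rightarrow> ('o, 'm, 'z) bimonad_scheme \<Rightarrow> 'o \<Rightarrow> 'm \<Rightarrow> bool" where
  "admits_coinvariants C T M \<rho> \<longleftrightarrow> (\<exists>i. is_coinvariants C T M \<rho> i)"

(* The equalizer is unique up to isomorphism and functors preserve isomorphisms,
   so quantifying over all equalizers agrees with using a chosen one. *)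
definition coinvariants_preserved :: "('o, 'm, 'x) monoidal_category_scheme
    \<Rightarrow> ('o, 'm, 'z) bimonad_scheme \<Rightarrow> 'o \<Rightarrow> 'm \<Rightarrow> bool" where
  "coinvariants_preserved C T M \<rho> \<longleftrightarrow> (\<forall>i. is_coinvariants C T M \<rho> i \<longrightarrow>
     is_equalizer C (FArr T \<rho>) (FArr T (Ident C M \<otimes>\<^bsub>C\<^esub> Eta T \<one>\<^bsub>C\<^esub>)) (FArr T i))"

end

theory Submission
  imports Defs
begin

text \<open>For a module \<open>(M, r)\<close> the fusion operator
  \<open>(r \<otimes> T(Y)) T\<^sub>2(M, Y) : T(M \<odot> Y) \<rightarrow> M \<odot> T(Y)\<close> is invertible: the antipode gives a
  morphism from \<open>T\<close> of the dual of \<open>M\<close> to that dual for which evaluation and coevaluation are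
  \<open>T\<close>-linear, and these yield the inverse. For a Hopf module with coinvariants \<open>i : N \<rightarrow> M\<close>, fusion
  turns the pair \<open>T(\<rho>), T(M \<otimes> \<eta>)\<close> into \<open>\<rho> \<otimes> T(1), M \<otimes> T\<^sub>2(1,1)\<close>, whose equalizer is \<open>\<rho>\<close>.
  Hence \<open>r T(i) : T(N) \<rightarrow> M\<close> is an isomorphism; this is the counit of the adjunction between free
  Hopf modules and coinvariants. By the triangle identity \<open>T\<close> sends the unit
  \<open>X \<rightarrow> T(X)\<^sup>c\<^sup>o\<^sup>T\<close> to an isomorphism, so the unit is invertible when \<open>T\<close> is conservative.
  Conversely an equivalence reflects isomorphisms, and the inverse of a Hopf module morphism
  is one.\<close>

section \<open>Categories and duals\<close>

lemma hom_iff: "f \<in> hom C X Y \<longleftrightarrow> f \<in> Arr C \<and> Dom C f = X \<and> Cod C f = Y"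
  by (auto simp: hom_def)

context category
begin

declare dom_obj [simp] cod_obj [simp]

lemma ident_arr [simp]:
  assumes "X \<in> Obj C"
  shows "Ident C X \<in> Arr C" "Dom C (Ident C X) = X" "Cod C (Ident C X) = X"
  using ident_hom[OF assms] by (auto simp: hom_iff)

lemma comp_arr [simp]:
  assumes "f \<in> Arr C" "g \<in> Arr C" "Dom C g = Cod C f"
  shows "g \<cdot> f \<in> Arr C" "Dom C (g \<cdot> f) = Dom C f" "Cod C (g \<cdot> f) = Cod C g"
  using comp_hom[of f "Dom C f" "Cod C f" g "Cod C g"] assms by (auto simp: hom_iff)

lemma comp_ident_arr [simp]: "f \<in> Arr C \<Longrightarrow> Dom C f = X \<Longrightarrow> f \<cdot> Ident C X = f"
  by (rule comp_ident) (auto simp: hom_iff)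

lemma ident_comp_arr [simp]: "f \<in> Arr C \<Longrightarrow> Cod C f = Y \<Longrightarrow> Ident C Y \<cdot> f = f"
  by (rule ident_comp) (auto simp: hom_iff)

lemma comp_assoc_arr [simp]:
  "f \<in> Arr C \<Longrightarrow> g \<in> Arr C \<Longrightarrow> h \<in> Arr C \<Longrightarrow> Dom C g = Cod C f \<Longrightarrow> Dom C h = Cod C g
    \<Longrightarrow> (h \<cdot> g) \<cdot> f = h \<cdot> (g \<cdot> f)"
  by (rule comp_assoc[symmetric]) (auto simp: hom_iff)

text \<open>Since \<open>comp_assoc_arr\<close> nests composites to the right, an identity in front
  of a composite needs a rule of its own.\<close>

lemma ident_comp_comp [simp]:
  "f \<in> Arr C \<Longrightarrow> g \<in> Arr C \<Longrightarrow> Dom C g = Cod C f \<Longrightarrow> Cod C g = Y \<Longrightarrow> Ident C Y \<cdot> (g \<cdot> f) = g \<cdot> f"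
  by simp

lemma is_isoI:
  assumes "f \<in> Arr C" "g \<in> Arr C" "Dom C g = Cod C f" "Cod C g = Dom C f"
    and "g \<cdot> f = Ident C (Dom C f)" "f \<cdot> g = Ident C (Cod C f)"
  shows "is_iso C f"
  unfolding is_iso_def using assms by (auto simp: hom_iff)

lemma is_isoE:
  assumes "is_iso C f"
  obtains g where "f \<in> Arr C" "g \<in> Arr C" "Dom C g = Cod C f" "Cod C g = Dom C f"
    "g \<cdot> f = Ident C (Dom C f)" "f \<cdot> g = Ident C (Cod C f)"
  using assms unfolding is_iso_def by (auto simp: hom_iff)

lemma is_iso_comp:
  assumes "is_iso C f" "is_iso C g" "Dom C g = Cod C f"
  shows "is_iso C (g \<cdot> f)"
proof -
  obtain f' where f: "f \<in> Arr C" "f' \<in> Arr C" "Dom C f' = Cod C f" "Cod C f' = Dom C f"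
    "f' \<cdot> f = Ident C (Dom C f)" "f \<cdot> f' = Ident C (Cod C f)"
    using assms(1) by (rule is_isoE)
  obtain g' where g: "g \<in> Arr C" "g' \<in> Arr C" "Dom C g' = Cod C g" "Cod C g' = Dom C g"
    "g' \<cdot> g = Ident C (Dom C g)" "g \<cdot> g' = Ident C (Cod C g)"
    using assms(2) by (rule is_isoE)
  have "(f' \<cdot> g') \<cdot> (g \<cdot> f) = f' \<cdot> ((g' \<cdot> g) \<cdot> f)"
    using f(1-4) g(1-4) assms(3) by simp
  moreover have "(g \<cdot> f) \<cdot> (f' \<cdot> g') = g \<cdot> ((f \<cdot> f') \<cdot> g')"
    using f(1-4) g(1-4) assms(3) by simp
  ultimately show ?thesis
    using f g assms(3) by (intro is_isoI[where g = "f' \<cdot> g'"]) simp_all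
qed

text \<open>Composing \<open>g \<cdot> f\<close> with the inverse of \<open>g\<close> exhibits
  \<open>f\<close> as a composite of isomorphisms.\<close>

lemma is_iso_cancel_left:
  assumes "is_iso C (g \<cdot> f)" "is_iso C g" "f \<in> Arr C" "Dom C g = Cod C f"
  shows "is_iso C f"
proof -
  obtain g' where g: "g \<in> Arr C" "g' \<in> Arr C" "Dom C g' = Cod C g" "Cod C g' = Dom C g"
    "g' \<cdot> g = Ident C (Dom C g)" "g \<cdot> g' = Ident C (Cod C g)"
    using assms(2) by (rule is_isoE)
  have "is_iso C g'"
    using g by (intro is_isoI[where g = g]) simp_all
  then have "is_iso C (g' \<cdot> (g \<cdot> f))"
    using assms g by (auto intro!: is_iso_comp[of "g \<cdot> f"])
  then have "is_iso C ((g' \<cdot> g) \<cdot> f)"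
    using g(1-4) assms(3,4) by simp
  then show ?thesis
    using g(5) assms(3,4) by (simp del: comp_assoc_arr)
qed

text \<open>An equalizer is monic: \<open>h\<close> and \<open>k\<close> are both factorizations of
  the same arrow \<open>i \<cdot> h\<close>, and such a factorization is unique.\<close>

lemma equalizer_mono:
  assumes "is_equalizer C f g i" "h \<in> Arr C" "k \<in> Arr C" "Cod C h = Dom C i" "Cod C k = Dom C i"
    and "i \<cdot> h = i \<cdot> k"
  shows "h = k"
proof -
  have i: "f \<in> Arr C" "g \<in> Arr C" "Dom C g = Dom C f" "i \<in> Arr C" "Cod C i = Dom C f" "f \<cdot> i = g \<cdot> i"
    using assms(1) by (auto simp: is_equalizer_def hom_iff)
  \<comment> \<open>Equality of the two domains is no hypothesis; it is read off from the equal
    composites.\<close>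
  have dom: "Dom C k = Dom C h"
    using arg_cong[OF assms(6), of "Dom C"] assms(2-5) i(4) by simp
  have "(f \<cdot> i) \<cdot> h = (g \<cdot> i) \<cdot> h"
    by (simp only: i(6))
  then have "f \<cdot> (i \<cdot> h) = g \<cdot> (i \<cdot> h)"
    using i(1-5) assms(2-5) by simp
  moreover have uniq: "\<exists>!l. l \<in> hom C (Dom C m) (Dom C i) \<and> i \<cdot> l = m"
    if "m \<in> Arr C" "Cod C m = Dom C f" "f \<cdot> m = g \<cdot> m" for m
    using assms(1) that unfolding is_equalizer_def by blast
  ultimately have "\<exists>!l. l \<in> hom C (Dom C (i \<cdot> h)) (Dom C i) \<and> i \<cdot> l = i \<cdot> h"
    using uniq[of "i \<cdot> h"] assms(2-5) i(4,5) by simp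
  then show ?thesis
    using assms(2-6) i(4) dom by (auto simp: hom_iff)
qed

lemma equalizerE:
  assumes "is_equalizer C f g i" "h \<in> Arr C" "Cod C h = Dom C f" "f \<cdot> h = g \<cdot> h"
  obtains k where "k \<in> Arr C" "Dom C k = Dom C h" "Cod C k = Dom C i" "i \<cdot> k = h"
  using assms unfolding is_equalizer_def hom_iff by metis

end

section \<open>Functors, and reflection of isomorphisms by equivalences\<close>

context cat_functor
begin

lemma map_arr [simp]:
  assumes "f \<in> Arr C"
  shows "FArr F f \<in> Arr D" "Dom D (FArr F f) = FObj F (Dom C f)" "Cod D (FArr F f) = FObj F (Cod C f)"
  using map_hom[of f "Dom C f" "Cod C f"] assms by (auto simp: hom_iff)

declare map_obj [simp] map_ident [simp]

lemma map_comp_arr [simp]: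
  "f \<in> Arr C \<Longrightarrow> g \<in> Arr C \<Longrightarrow> Dom C g = Cod C f \<Longrightarrow> FArr F (g \<cdot>\<^bsub>C\<^esub> f) = FArr F g \<cdot>\<^bsub>D\<^esub> FArr F f"
  by (rule map_comp) (auto simp: hom_iff)

lemma map_is_iso:
  assumes "is_iso C f"
  shows "is_iso D (FArr F f)"
proof -
  obtain g where g: "f \<in> Arr C" "g \<in> Arr C" "Dom C g = Cod C f" "Cod C g = Dom C f"
    "g \<cdot>\<^bsub>C\<^esub> f = Ident C (Dom C f)" "f \<cdot>\<^bsub>C\<^esub> g = Ident C (Cod C f)"
    using assms by (rule C.is_isoE)
  have "FArr F g \<cdot>\<^bsub>D\<^esub> FArr F f = Ident D (FObj F (Dom C f))"
    "FArr F f \<cdot>\<^bsub>D\<^esub> FArr F g = Ident D (FObj F (Cod C f))"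
    using map_comp_arr[of f g] map_comp_arr[of g f] g by simp_all
  then show ?thesis
    using g by (intro D.is_isoI[where g = "FArr F g"]) simp_all
qed

end

lemma cat_functor_id: "category C \<Longrightarrow> cat_functor C C id_functor"
  by (simp add: cat_functor_def cat_functor_axioms_def id_functor_def)

lemma cat_functor_comp:
  assumes "cat_functor C D F" "cat_functor D E G"
  shows "cat_functor C E (comp_functor G F)"
proof -
  interpret F: cat_functor C D F by fact
  interpret G: cat_functor D E G by fact
  show ?thesis
    by unfold_locales (auto simp: comp_functor_def hom_iff)
qed

text \<open>Naturality of \<open>\<alpha>\<close> gives
  \<open>\<alpha> Y \<cdot> f = G(F(f)) \<cdot> \<alpha> X\<close> for \<open>f\<close> from
  \<open>X\<close> to \<open>Y\<close>. If \<open>F(f)\<close> is invertible, so is the right side,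
  and the invertible \<open>\<alpha> Y\<close> cancels on the left.\<close>

lemma equivalence_conservative:
  fixes C :: "('o, 'm, 'x) category_scheme" and D :: "('p, 'n, 'y) category_scheme"
  assumes "is_equivalence C D F"
  shows "conservative C D F"
proof -
  obtain G :: "('p, 'n, 'o, 'm) functor_data" and \<alpha> where F: "cat_functor C D F" and G: "cat_functor D C G"
    and \<alpha>: "nat_iso C C id_functor (comp_functor G F) \<alpha>"
    using assms unfolding is_equivalence_def by blast
  interpret F: cat_functor C D F by (fact F)
  interpret G: cat_functor D C G by (fact G)
  interpret \<alpha>: nat_trans C C id_functor "comp_functor G F" \<alpha>
    using \<alpha> by (simp add: nat_iso_def)
  have iso: "is_iso C (\<alpha> X)" if "X \<in> Obj C" for X
    using \<alpha> that by (simp add: nat_iso_def)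
  have comp: "\<alpha> X \<in> Arr C \<and> Dom C (\<alpha> X) = X \<and> Cod C (\<alpha> X) = FObj G (FObj F X)" if "X \<in> Obj C" for X
    using \<alpha>.component_hom[OF that] by (simp add: hom_iff id_functor_def comp_functor_def)
  show ?thesis
    unfolding conservative_def
  proof (intro ballI impI)
    fix f assume f: "f \<in> Arr C" and Ff: "is_iso D (FArr F f)"
    have "is_iso C (FArr G (FArr F f) \<cdot>\<^bsub>C\<^esub> \<alpha> (Dom C f))"
      using f comp[of "Dom C f"] iso[of "Dom C f"] G.map_is_iso[OF Ff]
      by (auto intro!: F.C.is_iso_comp)
    then have "is_iso C (\<alpha> (Cod C f) \<cdot>\<^bsub>C\<^esub> f)"
      using \<alpha>.natural[of f "Dom C f" "Cod C f"] f by (simp add: hom_iff id_functor_def comp_functor_def)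
    then show "is_iso C f"
      using f iso[of "Cod C f"] comp[of "Cod C f"] by (auto intro: F.C.is_iso_cancel_left)
  qed
qed

section \<open>Interchange in a strict monoidal category\<close>

context strict_monoidal_category
begin

declare unit_obj [simp] ten_obj [simp] ten_ident [simp] ten_obj_assoc [simp] ten_arr_assoc [simp]
  unit_ten_obj [simp] ten_unit_obj [simp] unit_ten_arr [simp] ten_unit_arr [simp]

lemma ten_arr [simp]:
  assumes "f \<in> Arr C" "g \<in> Arr C"
  shows "f \<otimes> g \<in> Arr C" "Dom C (f \<otimes> g) = Dom C f \<odot> Dom C g" "Cod C (f \<otimes> g) = Cod C f \<odot> Cod C g"
  using ten_hom[of f "Dom C f" "Cod C f" g "Dom C g" "Cod C g"] assms by (auto simp: hom_iff)

lemma ten_comp_ten [simp]: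
  "f \<in> Arr C \<Longrightarrow> f' \<in> Arr C \<Longrightarrow> g \<in> Arr C \<Longrightarrow> g' \<in> Arr C \<Longrightarrow> Dom C f' = Cod C f \<Longrightarrow> Dom C g' = Cod C g
    \<Longrightarrow> (f' \<otimes> g') \<cdot> (f \<otimes> g) = (f' \<cdot> f) \<otimes> (g' \<cdot> g)"
  by (rule interchange[symmetric]) (auto simp: hom_iff)

text \<open>The interchange law with a trailing factor \<open>h\<close>, so that it also applies
  inside right-nested composites.\<close>

lemma ten_comp_ten_comp [simp]:
  assumes "f \<in> Arr C" "f' \<in> Arr C" "g \<in> Arr C" "g' \<in> Arr C" "Dom C f' = Cod C f" "Dom C g' = Cod C g"
    and "h \<in> Arr C" "Cod C h = Dom C f \<odot> Dom C g"
  shows "(f' \<otimes> g') \<cdot> ((f \<otimes> g) \<cdot> h) = ((f' \<cdot> f) \<otimes> (g' \<cdot> g)) \<cdot> h"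
  using assms by (simp flip: comp_assoc_arr)

lemma comp_ten_ident:
  "f \<in> Arr C \<Longrightarrow> g \<in> Arr C \<Longrightarrow> Dom C g = Cod C f \<Longrightarrow> Z \<in> Obj C
    \<Longrightarrow> (g \<cdot> f) \<otimes> Ident C Z = (g \<otimes> Ident C Z) \<cdot> (f \<otimes> Ident C Z)"
  by simp

end

section \<open>Right duals of arrows\<close>

context right_autonomous_category
begin

declare rdual_obj [simp]

lemma rev_arr [simp]:
  assumes "X \<in> Obj C"
  shows "REv C X \<in> Arr C" "Dom C (REv C X) = X \<odot> RDual C X" "Cod C (REv C X) = \<one>"
  using rev_hom[OF assms] by (auto simp: hom_iff)

lemma rcoev_arr [simp]:
  assumes "X \<in> Obj C"
  shows "RCoev C X \<in> Arr C" "Dom C (RCoev C X) = \<one>" "Cod C (RCoev C X) = RDual C X \<odot> X"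
  using rcoev_hom[OF assms] by (auto simp: hom_iff)

lemma rdual_arr_arr [simp]:
  assumes "f \<in> Arr C"
  shows "rdual_arr C f \<in> Arr C" "Dom C (rdual_arr C f) = RDual C (Cod C f)"
    "Cod C (rdual_arr C f) = RDual C (Dom C f)"
  using assms by (simp_all add: rdual_arr_def)

text \<open>Dinaturality of evaluation: the dual of \<open>f\<close> is the transpose of
  \<open>f\<close> followed by evaluation, and pairing it with \<open>X\<close> undoes the
  transposition by the first zigzag identity.\<close>

lemma rev_rdual_arr:
  assumes f: "f \<in> Arr C" "Dom C f = X" "Cod C f = Y"
  shows "REv C X \<cdot> (Ident C X \<otimes> rdual_arr C f) = REv C Y \<cdot> (f \<otimes> Ident C (RDual C Y))"
proof -
  let ?I = "Ident C"
  have XY [simp]: "X \<in> Obj C" "Y \<in> Obj C" using f by auto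
  define q where "q = REv C Y \<cdot> (f \<otimes> ?I (RDual C Y))"
  have q [simp]: "q \<in> Arr C" "Dom C q = X \<odot> RDual C Y" "Cod C q = \<one>"
    using f by (simp_all add: q_def)
  have "rdual_arr C f = (?I (RDual C X) \<otimes> q) \<cdot> (RCoev C X \<otimes> ?I (RDual C Y))"
    using f by (simp add: rdual_arr_def q_def)
  then have "REv C X \<cdot> (?I X \<otimes> rdual_arr C f)
      = REv C X \<cdot> (?I X \<otimes> ((?I (RDual C X) \<otimes> q) \<cdot> (RCoev C X \<otimes> ?I (RDual C Y))))"
    by simp
  also have "\<dots> = REv C X \<cdot> ((?I X \<otimes> ?I (RDual C X) \<otimes> q) \<cdot> (?I X \<otimes> RCoev C X \<otimes> ?I (RDual C Y)))"
    by (simp del: ten_ident)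
  also have "\<dots> = ((REv C X \<otimes> ?I \<one>) \<cdot> (?I (X \<odot> RDual C X) \<otimes> q)) \<cdot> (?I X \<otimes> RCoev C X \<otimes> ?I (RDual C Y))"
    by (simp del: ten_comp_ten ten_comp_ten_comp flip: ten_arr_assoc)
  \<comment> \<open>The evaluation of \<open>X\<close> and \<open>q\<close> act on different tensor
    factors, so their order can be exchanged; evaluation then meets the coevaluation of
    \<open>X\<close>.\<close>
  also have "\<dots> = ((?I \<one> \<otimes> q) \<cdot> (REv C X \<otimes> ?I (X \<odot> RDual C Y))) \<cdot> (?I X \<otimes> RCoev C X \<otimes> ?I (RDual C Y))"
    by (simp del: ten_unit_arr unit_ten_arr)
  also have "\<dots> = q \<cdot> (((REv C X \<otimes> ?I X) \<otimes> ?I (RDual C Y)) \<cdot> ((?I X \<otimes> RCoev C X) \<otimes> ?I (RDual C Y)))"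
    by (simp del: ten_comp_ten ten_comp_ten_comp)
  also have "\<dots> = q \<cdot> (((REv C X \<otimes> ?I X) \<cdot> (?I X \<otimes> RCoev C X)) \<otimes> ?I (RDual C Y))"
    by (simp del: ten_arr_assoc)
  also have "\<dots> = q"
    by (simp add: rdual_zigzag1)
  finally show ?thesis by (simp add: q_def)
qed

text \<open>The second zigzag identity reconstructs \<open>g\<close> from its pairing with
  \<open>X\<close>. Identities between duals of arrows are therefore checked after
  evaluation.\<close>

lemma rdual_arr_unique:
  assumes f: "f \<in> Arr C" "Dom C f = X" "Cod C f = Y"
    and g: "g \<in> Arr C" "Dom C g = RDual C Y" "Cod C g = RDual C X"
    and eq: "REv C X \<cdot> (Ident C X \<otimes> g) = REv C Y \<cdot> (f \<otimes> Ident C (RDual C Y))"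
  shows "g = rdual_arr C f"
proof -
  let ?I = "Ident C"
  have XY [simp]: "X \<in> Obj C" "Y \<in> Obj C" using f by auto
  have "g = ((?I (RDual C X) \<otimes> REv C X) \<cdot> (RCoev C X \<otimes> ?I (RDual C X))) \<cdot> g"
    using g by (simp add: rdual_zigzag2 del: comp_assoc_arr)
  also have "\<dots> = (?I (RDual C X) \<otimes> REv C X) \<cdot> ((RCoev C X \<otimes> ?I (RDual C X)) \<cdot> (?I \<one> \<otimes> g))"
    using g by (simp del: ten_comp_ten ten_comp_ten_comp)
  also have "\<dots> = (?I (RDual C X) \<otimes> REv C X) \<cdot> ((?I (RDual C X \<odot> X) \<otimes> g) \<cdot> (RCoev C X \<otimes> ?I (RDual C Y)))"
    using g by (simp del: unit_ten_arr)
  also have "\<dots> = (?I (RDual C X) \<otimes> (REv C X \<cdot> (?I X \<otimes> g))) \<cdot> (RCoev C X \<otimes> ?I (RDual C Y))"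
    using g by (simp flip: ten_ident)
  also have "\<dots> = rdual_arr C f"
    using f by (simp add: eq rdual_arr_def)
  finally show ?thesis .
qed

text \<open>Contravariant functoriality of the dual: by two uses of \<open>rev_rdual_arr\<close> the
  right side has the pairing that characterizes the left side.\<close>

lemma rdual_arr_comp:
  assumes f: "f \<in> Arr C" and g: "g \<in> Arr C" and fg: "Dom C g = Cod C f"
  shows "rdual_arr C (g \<cdot> f) = rdual_arr C f \<cdot> rdual_arr C g"
proof -
  let ?I = "Ident C"
  let ?X = "Dom C f" and ?Y = "Cod C f" and ?Z = "Cod C g"
  have "REv C ?X \<cdot> (?I ?X \<otimes> (rdual_arr C f \<cdot> rdual_arr C g))
      = (REv C ?X \<cdot> (?I ?X \<otimes> rdual_arr C f)) \<cdot> (?I ?X \<otimes> rdual_arr C g)"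
    using f g fg by simp
  also have "\<dots> = (REv C ?Y \<cdot> (?I ?Y \<otimes> rdual_arr C g)) \<cdot> (f \<otimes> ?I (RDual C ?Z))"
    using f g fg by (simp add: rev_rdual_arr[of f ?X ?Y] del: ident_comp_comp)
  also have "\<dots> = REv C ?Z \<cdot> ((g \<cdot> f) \<otimes> ?I (RDual C ?Z))"
    using f g fg by (simp add: rev_rdual_arr[of g ?Y ?Z])
  finally show ?thesis
    using f g fg by (intro rdual_arr_unique[symmetric, of _ ?X ?Z]) simp_all
qed

lemma rdual_arr_ident: "X \<in> Obj C \<Longrightarrow> rdual_arr C (Ident C X) = Ident C (RDual C X)"
  by (intro rdual_arr_unique[symmetric, of _ X X]) simp_all

text \<open>The coevaluation counterpart of \<open>rev_rdual_arr\<close>. Expanding the dual of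
  \<open>f\<close> leaves the zigzag of \<open>Y\<close> acting behind \<open>f\<close>, which
  collapses to \<open>f\<close>.\<close>

lemma rdual_arr_rcoev:
  assumes f: "f \<in> Arr C" "Dom C f = X" "Cod C f = Y"
  shows "(rdual_arr C f \<otimes> Ident C Y) \<cdot> RCoev C Y = (Ident C (RDual C X) \<otimes> f) \<cdot> RCoev C X"
proof -
  let ?I = "Ident C"
  have XY [simp]: "X \<in> Obj C" "Y \<in> Obj C" using f by auto
  define q where "q = REv C Y \<cdot> (f \<otimes> ?I (RDual C Y))"
  have q [simp]: "q \<in> Arr C" "Dom C q = X \<odot> RDual C Y" "Cod C q = \<one>"
    using f by (simp_all add: q_def)
  have rd: "rdual_arr C f = (?I (RDual C X) \<otimes> q) \<cdot> (RCoev C X \<otimes> ?I (RDual C Y))"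
    using f by (simp add: rdual_arr_def q_def)
  have "rdual_arr C f \<otimes> ?I Y = (?I (RDual C X) \<otimes> (q \<otimes> ?I Y)) \<cdot> (RCoev C X \<otimes> ?I (RDual C Y \<odot> Y))"
    unfolding rd by (simp flip: ten_ident ten_arr_assoc)
  then have "(rdual_arr C f \<otimes> ?I Y) \<cdot> RCoev C Y
      = (?I (RDual C X) \<otimes> (q \<otimes> ?I Y)) \<cdot> ((RCoev C X \<otimes> ?I (RDual C Y \<odot> Y)) \<cdot> (?I \<one> \<otimes> RCoev C Y))"
    by (simp del: ten_comp_ten ten_comp_ten_comp)
  also have "\<dots> = (?I (RDual C X) \<otimes> (q \<otimes> ?I Y)) \<cdot> ((?I (RDual C X \<odot> X) \<otimes> RCoev C Y) \<cdot> (RCoev C X \<otimes> ?I \<one>))"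
    by (simp del: unit_ten_arr ten_unit_arr ten_comp_ten_comp)
  also have "\<dots> = (?I (RDual C X) \<otimes> (q \<otimes> ?I Y)) \<cdot> ((?I (RDual C X) \<otimes> (?I X \<otimes> RCoev C Y)) \<cdot> RCoev C X)"
    by (simp del: ten_comp_ten ten_comp_ten_comp flip: ten_arr_assoc)
  also have "\<dots> = (?I (RDual C X) \<otimes> ((q \<otimes> ?I Y) \<cdot> (?I X \<otimes> RCoev C Y))) \<cdot> RCoev C X"
    by simp
  \<comment> \<open>Inside the right tensor factor, \<open>f\<close> is moved in front of the
    coevaluation of \<open>Y\<close> to expose the first zigzag identity.\<close>
  also have "(q \<otimes> ?I Y) \<cdot> (?I X \<otimes> RCoev C Y)
      = (REv C Y \<otimes> ?I Y) \<cdot> ((f \<otimes> ?I (RDual C Y \<odot> Y)) \<cdot> (?I X \<otimes> RCoev C Y))"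
    using f by (simp add: q_def comp_ten_ident del: ten_comp_ten ten_comp_ten_comp)
  also have "\<dots> = (REv C Y \<otimes> ?I Y) \<cdot> ((?I Y \<otimes> RCoev C Y) \<cdot> (f \<otimes> ?I \<one>))"
    using f by (simp del: ten_unit_arr)
  also have "\<dots> = ((REv C Y \<otimes> ?I Y) \<cdot> (?I Y \<otimes> RCoev C Y)) \<cdot> f"
    using f by (simp del: ten_comp_ten ten_comp_ten_comp)
  also have "\<dots> = f"
    using f by (simp add: rdual_zigzag1 del: comp_assoc_arr)
  finally show ?thesis .
qed

end

section \<open>Monads and Hopf modules\<close>

context monad
begin

lemma mu_arr [simp]:
  assumes "X \<in> Obj C"
  shows "Mu T X \<in> Arr C" "Dom C (Mu T X) = FObj T (FObj T X)" "Cod C (Mu T X) = FObj T X"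
  using mu.component_hom[OF assms] by (auto simp: hom_iff comp_functor_def)

lemma eta_arr [simp]:
  assumes "X \<in> Obj C"
  shows "Eta T X \<in> Arr C" "Dom C (Eta T X) = X" "Cod C (Eta T X) = FObj T X"
  using eta.component_hom[OF assms] by (auto simp: hom_iff id_functor_def)

lemma mu_natural:
  assumes "f \<in> Arr C" "Dom C f = X" "Cod C f = Y"
  shows "Mu T Y \<cdot> FArr T (FArr T f) = FArr T f \<cdot> Mu T X"
  using mu.natural[of f X Y] assms by (simp add: hom_iff comp_functor_def)

lemma eta_natural:
  assumes "f \<in> Arr C" "Dom C f = X" "Cod C f = Y"
  shows "Eta T Y \<cdot> f = FArr T f \<cdot> Eta T X"
  using eta.natural[of f X Y] assms by (simp add: hom_iff id_functor_def)

lemma moduleD: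
  assumes "is_module C T M r"
  shows "M \<in> Obj C" "r \<in> Arr C" "Dom C r = FObj T M" "Cod C r = M"
  using assms by (auto simp: is_module_def hom_iff)

lemma module_assoc: "is_module C T M r \<Longrightarrow> r \<cdot> FArr T r = r \<cdot> Mu T M"
  by (simp add: is_module_def)

lemma module_unit: "is_module C T M r \<Longrightarrow> r \<cdot> Eta T M = Ident C M"
  by (simp add: is_module_def)

lemma free_module: "X \<in> Obj C \<Longrightarrow> is_module C T (FObj T X) (Mu T X)"
  by (simp add: is_module_def hom_iff mu_assoc mu_eta)

end

section \<open>Fusion operators and tensor products of modules over a bimonad\<close>

context bimonad
begin

lemma cop_arr [simp]:
  assumes "X \<in> Obj C" "Y \<in> Obj C"
  shows "T\<^sub>2\<^bsub>T\<^esub> X Y \<in> Arr C" "Dom C (T\<^sub>2\<^bsub>T\<^esub> X Y) = FObj T (X \<odot> Y)"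
    "Cod C (T\<^sub>2\<^bsub>T\<^esub> X Y) = FObj T X \<odot> FObj T Y"
  using cop_hom[OF assms] by (auto simp: hom_iff)

lemma cou_arr [simp]: "T\<^sub>0\<^bsub>T\<^esub> \<in> Arr C" "Dom C T\<^sub>0\<^bsub>T\<^esub> = FObj T \<one>" "Cod C T\<^sub>0\<^bsub>T\<^esub> = \<one>"
  using cou_hom by (auto simp: hom_iff)

lemma cop_natural_arr:
  assumes "f \<in> Arr C" "Dom C f = X" "Cod C f = X'" "g \<in> Arr C" "Dom C g = Y" "Cod C g = Y'"
  shows "T\<^sub>2\<^bsub>T\<^esub> X' Y' \<cdot> FArr T (f \<otimes> g) = (FArr T f \<otimes> FArr T g) \<cdot> T\<^sub>2\<^bsub>T\<^esub> X Y"
  using cop_natural[of f X X' g Y Y'] assms by (simp add: hom_iff)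

text \<open>For the free module on \<open>X\<close> this is the right fusion operator of the bimonad
  at \<open>X\<close> and \<open>Y\<close>. Arbitrary modules are allowed because it is applied to
  the underlying module of a Hopf module.\<close>

definition fusion :: "'o \<Rightarrow> 'm \<Rightarrow> 'o \<Rightarrow> 'm" where
  "fusion M r Y = (r \<otimes> Ident C (FObj T Y)) \<cdot> T\<^sub>2\<^bsub>T\<^esub> M Y"

lemma fusion_arr [simp]:
  assumes "is_module C T M r" "Y \<in> Obj C"
  shows "fusion M r Y \<in> Arr C" "Dom C (fusion M r Y) = FObj T (M \<odot> Y)"
    "Cod C (fusion M r Y) = M \<odot> FObj T Y"
  using assms by (simp_all add: fusion_def moduleD[OF assms(1)])

lemma cop_natural_comp:
  assumes "f \<in> Arr C" "Dom C f = X" "Cod C f = X'" "g \<in> Arr C" "Dom C g = Y" "Cod C g = Y'"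
    and "h \<in> Arr C" "Cod C h = FObj T (X \<odot> Y)"
  shows "T\<^sub>2\<^bsub>T\<^esub> X' Y' \<cdot> (FArr T (f \<otimes> g) \<cdot> h) = (FArr T f \<otimes> FArr T g) \<cdot> (T\<^sub>2\<^bsub>T\<^esub> X Y \<cdot> h)"
proof -
  have [simp]: "X \<in> Obj C" "Y \<in> Obj C" "X' \<in> Obj C" "Y' \<in> Obj C"
    using assms by auto
  have "T\<^sub>2\<^bsub>T\<^esub> X' Y' \<cdot> (FArr T (f \<otimes> g) \<cdot> h) = (T\<^sub>2\<^bsub>T\<^esub> X' Y' \<cdot> FArr T (f \<otimes> g)) \<cdot> h"
    using assms by simp
  then show ?thesis
    using assms by (simp add: cop_natural_arr[OF assms(1-6)])
qed

definition tensor_action :: "'o \<Rightarrow> 'm \<Rightarrow> 'o \<Rightarrow> 'm \<Rightarrow> 'm" where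
  "tensor_action M r N s = (r \<otimes> s) \<cdot> T\<^sub>2\<^bsub>T\<^esub> M N"

text \<open>The bimonad axioms lift the tensor product to modules: compatibility of
  \<open>T\<^sub>2\<close> with the multiplication gives associativity of the action, compatibility
  with the unit gives its unit law.\<close>

lemma tensor_module:
  assumes M: "is_module C T M r" and N: "is_module C T N s"
  shows "is_module C T (M \<odot> N) (tensor_action M r N s)"
proof -
  note [simp] = moduleD[OF M] moduleD[OF N]
  have "tensor_action M r N s \<cdot> FArr T (tensor_action M r N s)
      = (r \<otimes> s) \<cdot> (T\<^sub>2\<^bsub>T\<^esub> M N \<cdot> (FArr T (r \<otimes> s) \<cdot> FArr T (T\<^sub>2\<^bsub>T\<^esub> M N)))"
    by (simp add: tensor_action_def)
  also have "\<dots> = ((r \<cdot> FArr T r) \<otimes> (s \<cdot> FArr T s)) \<cdot> (T\<^sub>2\<^bsub>T\<^esub> (FObj T M) (FObj T N) \<cdot> FArr T (T\<^sub>2\<^bsub>T\<^esub> M N))"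
    by (simp add: cop_natural_comp)
  also have "\<dots> = (r \<otimes> s) \<cdot> ((Mu T M \<otimes> Mu T N) \<cdot> T\<^sub>2\<^bsub>T\<^esub> (FObj T M) (FObj T N) \<cdot> FArr T (T\<^sub>2\<^bsub>T\<^esub> M N))"
    by (simp add: module_assoc[OF M] module_assoc[OF N])
  also have "\<dots> = tensor_action M r N s \<cdot> Mu T (M \<odot> N)"
    by (simp add: tensor_action_def cop_mu)
  finally have "tensor_action M r N s \<cdot> FArr T (tensor_action M r N s) = tensor_action M r N s \<cdot> Mu T (M \<odot> N)" .
  moreover have "tensor_action M r N s \<cdot> Eta T (M \<odot> N) = Ident C (M \<odot> N)"
    by (simp add: tensor_action_def cop_eta module_unit[OF M] module_unit[OF N])
  ultimately show ?thesis
    by (simp add: is_module_def hom_iff tensor_action_def)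
qed

text \<open>Naturality of \<open>T\<^sub>2\<close> moves \<open>f\<close> past the coproduct, and
  linearity moves it past the action.\<close>

lemma fusion_natural:
  assumes M: "is_module C T M r" and N: "is_module C T N s" and Y: "Y \<in> Obj C"
    and f: "f \<in> Arr C" "Dom C f = M" "Cod C f = N" and lin: "f \<cdot> r = s \<cdot> FArr T f"
  shows "fusion N s Y \<cdot> FArr T (f \<otimes> Ident C Y) = (f \<otimes> Ident C (FObj T Y)) \<cdot> fusion M r Y"
proof -
  note [simp] = moduleD[OF M] moduleD[OF N] Y
  have "fusion N s Y \<cdot> FArr T (f \<otimes> Ident C Y)
      = (s \<otimes> Ident C (FObj T Y)) \<cdot> (T\<^sub>2\<^bsub>T\<^esub> N Y \<cdot> FArr T (f \<otimes> Ident C Y))"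
    using f by (simp add: fusion_def)
  also have "\<dots> = (f \<otimes> Ident C (FObj T Y)) \<cdot> fusion M r Y"
    using f by (simp add: cop_natural_arr[of f M N _ Y Y] fusion_def lin)
  finally show ?thesis .
qed

section \<open>Hopf modules and the comparison with free ones\<close>

abbreviation "T1 \<equiv> FObj T \<one>"

text \<open>The Hopf compatibility is restated as linearity of \<open>\<rho>\<close> into the tensor
  product of \<open>M\<close> with the free module on the unit object, the form to which
  \<open>fusion_natural\<close> applies.\<close>

lemma hopf_moduleD:
  assumes "is_right_hopf_module C T M r \<rho>"
  shows "is_module C T M r" "\<rho> \<in> Arr C" "Dom C \<rho> = M" "Cod C \<rho> = M \<odot> T1"
    "(\<rho> \<otimes> Ident C T1) \<cdot> \<rho> = (Ident C M \<otimes> T\<^sub>2\<^bsub>T\<^esub> \<one> \<one>) \<cdot> \<rho>"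
    "(Ident C M \<otimes> T\<^sub>0\<^bsub>T\<^esub>) \<cdot> \<rho> = Ident C M"
    "\<rho> \<cdot> r = tensor_action M r T1 (Mu T \<one>) \<cdot> FArr T \<rho>"
  using assms by (auto simp: is_right_hopf_module_def is_right_comodule_def hom_iff
      tensor_action_def is_module_def)

lemma coinvariantsD:
  assumes "is_coinvariants C T M \<rho> i" "is_right_hopf_module C T M r \<rho>"
  shows "i \<in> Arr C" "Cod C i = M" "\<rho> \<cdot> i = (Ident C M \<otimes> Eta T \<one>) \<cdot> i"
  using assms(1) hopf_moduleD(3)[OF assms(2)] by (auto simp: is_coinvariants_def is_equalizer_def)

text \<open>Coassociativity and counitality of \<open>T\<^sub>2\<close> at the unit object are the
  comodule laws, and \<open>cop_mu\<close> is the Hopf compatibility.\<close>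

lemma free_hopf_module:
  assumes [simp]: "X \<in> Obj C"
  shows "is_right_hopf_module C T (FObj T X) (Mu T X) (T\<^sub>2\<^bsub>T\<^esub> X \<one>)"
  using cop_coassoc[of X \<one> \<one>] cop_counit_right[of X] cop_mu[of X \<one>]
  by (simp add: is_right_hopf_module_def free_module is_right_comodule_def hom_iff)

lemma cop_comodule_arr:
  assumes "f \<in> Arr C" "Dom C f = X" "Cod C f = Y"
  shows "T\<^sub>2\<^bsub>T\<^esub> Y \<one> \<cdot> FArr T f = (FArr T f \<otimes> Ident C T1) \<cdot> T\<^sub>2\<^bsub>T\<^esub> X \<one>"
  using cop_natural_arr[of f X Y "Ident C \<one>" \<one> \<one>] assms by simp

text \<open>Linearity of \<open>\<rho>\<close> brings it under \<open>T\<close> next to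
  \<open>i\<close>, where the equalizer property replaces it by the unit
  \<open>Eta T \<one>\<close>; the multiplication in the tensor action then absorbs this
  unit.\<close>

lemma coaction_comparison:
  assumes hm: "is_right_hopf_module C T M r \<rho>" and i: "is_coinvariants C T M \<rho> i"
  shows "\<rho> \<cdot> (r \<cdot> FArr T i) = fusion M r \<one> \<cdot> FArr T i"
proof -
  note [simp] = hopf_moduleD(2-4)[OF hm] moduleD[OF hopf_moduleD(1)[OF hm]] coinvariantsD(1,2)[OF i hm]
  have "\<rho> \<cdot> (r \<cdot> FArr T i) = (\<rho> \<cdot> r) \<cdot> FArr T i" by simp
  also have "\<dots> = tensor_action M r T1 (Mu T \<one>) \<cdot> FArr T (\<rho> \<cdot> i)"
    by (simp add: hopf_moduleD(7)[OF hm] tensor_action_def)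
  also have "\<dots> = (r \<otimes> Mu T \<one>) \<cdot> (T\<^sub>2\<^bsub>T\<^esub> M T1 \<cdot> (FArr T (Ident C M \<otimes> Eta T \<one>) \<cdot> FArr T i))"
    by (simp add: coinvariantsD(3)[OF i hm] tensor_action_def)
  also have "\<dots> = fusion M r \<one> \<cdot> FArr T i"
    by (simp add: cop_natural_comp[of _ M M _ \<one>] mu_map_eta fusion_def)
  finally show ?thesis .
qed

lemma fusion_coaction:
  assumes hm: "is_right_hopf_module C T M r \<rho>"
  shows "fusion (M \<odot> T1) (tensor_action M r T1 (Mu T \<one>)) \<one> \<cdot> FArr T \<rho> = (\<rho> \<otimes> Ident C T1) \<cdot> fusion M r \<one>"
  using fusion_natural[of M r "M \<odot> T1" "tensor_action M r T1 (Mu T \<one>)" \<one> \<rho>] hopf_moduleD[OF hm]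
  by (simp add: tensor_module free_module)

text \<open>Acting after \<open>T(M \<otimes> \<eta>)\<close> amounts to fusion, since the
  multiplication absorbs the unit. Two successive fusions then appear, and coassociativity merges
  them. Together with \<open>fusion_coaction\<close> this describes how fusion transports the
  parallel pair.\<close>

lemma fusion_unit:
  assumes M: "is_module C T M r"
  shows "fusion (M \<odot> T1) (tensor_action M r T1 (Mu T \<one>)) \<one> \<cdot> FArr T (Ident C M \<otimes> Eta T \<one>)
    = (Ident C M \<otimes> T\<^sub>2\<^bsub>T\<^esub> \<one> \<one>) \<cdot> fusion M r \<one>"
proof -
  note [simp] = moduleD[OF M] M
  let ?I = "Ident C" and ?e = "Ident C M \<otimes> Eta T \<one>" and ?t = "tensor_action M r T1 (Mu T \<one>)"
  have t [simp]: "?t \<in> Arr C" "Dom C ?t = FObj T (M \<odot> T1)" "Cod C ?t = M \<odot> T1"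
    by (simp_all add: tensor_action_def)
  have te: "?t \<cdot> FArr T ?e = fusion M r \<one>"
    by (simp add: tensor_action_def cop_natural_arr[of _ M M _ \<one>] mu_map_eta fusion_def)
  have "fusion (M \<odot> T1) ?t \<one> \<cdot> FArr T ?e = (?t \<otimes> ?I T1) \<cdot> (T\<^sub>2\<^bsub>T\<^esub> (M \<odot> T1) \<one> \<cdot> FArr T ?e)"
    by (simp add: fusion_def)
  also have "\<dots> = (fusion M r \<one> \<otimes> ?I T1) \<cdot> T\<^sub>2\<^bsub>T\<^esub> M \<one>"
    by (simp add: cop_comodule_arr[of ?e M "M \<odot> T1"] te)
  also have "\<dots> = ((r \<otimes> ?I T1) \<otimes> ?I T1) \<cdot> ((T\<^sub>2\<^bsub>T\<^esub> M \<one> \<otimes> ?I T1) \<cdot> T\<^sub>2\<^bsub>T\<^esub> M \<one>)"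
    by (simp add: fusion_def del: ten_arr_assoc)
  also have "(T\<^sub>2\<^bsub>T\<^esub> M \<one> \<otimes> ?I T1) \<cdot> T\<^sub>2\<^bsub>T\<^esub> M \<one> = (?I (FObj T M) \<otimes> T\<^sub>2\<^bsub>T\<^esub> \<one> \<one>) \<cdot> T\<^sub>2\<^bsub>T\<^esub> M \<one>"
    using cop_coassoc[of M \<one> \<one>] by simp
  also have "((r \<otimes> ?I T1) \<otimes> ?I T1) \<cdot> \<dots> = (?I M \<otimes> T\<^sub>2\<^bsub>T\<^esub> \<one> \<one>) \<cdot> fusion M r \<one>"
    by (simp add: fusion_def)
  finally show ?thesis .
qed

lemma counit_fusion:
  assumes M: "is_module C T M r"
  shows "(Ident C M \<otimes> T\<^sub>0\<^bsub>T\<^esub>) \<cdot> fusion M r \<one> = r"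
proof -
  note [simp] = moduleD[OF M] M
  have "(Ident C M \<otimes> T\<^sub>0\<^bsub>T\<^esub>) \<cdot> fusion M r \<one> = (r \<otimes> Ident C \<one>) \<cdot> ((Ident C (FObj T M) \<otimes> T\<^sub>0\<^bsub>T\<^esub>) \<cdot> T\<^sub>2\<^bsub>T\<^esub> M \<one>)"
    by (simp add: fusion_def del: ten_unit_arr)
  then show ?thesis by (simp add: cop_counit_right del: ten_comp_ten_comp)
qed

text \<open>The fusion operators identify the pair of which \<open>T(i)\<close> is the equalizer with
  \<open>\<rho> \<otimes> T(1)\<close> and \<open>M \<otimes> T\<^sub>2(1,1)\<close>, whose (split) equalizer is \<open>\<rho>\<close>.\<close>

lemma comparison_is_iso:
  assumes hm: "is_right_hopf_module C T M r \<rho>" and i: "is_coinvariants C T M \<rho> i"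
    and eq: "is_equalizer C (FArr T \<rho>) (FArr T (Ident C M \<otimes> Eta T \<one>)) (FArr T i)"
    and H: "is_iso C (fusion M r \<one>)"
    and H1: "is_iso C (fusion (M \<odot> T1) (tensor_action M r T1 (Mu T \<one>)) \<one>)"
  shows "is_iso C (r \<cdot> FArr T i)"
proof -
  have M: "is_module C T M r" using hm by (rule hopf_moduleD)
  note [simp] = hopf_moduleD(2-4)[OF hm] moduleD[OF M] coinvariantsD(1,2)[OF i hm]
  let ?H = "fusion M r \<one>" and ?H1 = "fusion (M \<odot> T1) (tensor_action M r T1 (Mu T \<one>)) \<one>"
  let ?e = "Ident C M \<otimes> Eta T \<one>"
  have Ha [simp]: "?H \<in> Arr C" "Dom C ?H = FObj T M" "Cod C ?H = M \<odot> T1"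
    using M by simp_all
  have H1a [simp]: "?H1 \<in> Arr C" "Dom C ?H1 = FObj T (M \<odot> T1)" "Cod C ?H1 = M \<odot> T1 \<odot> T1"
    using tensor_module[OF M free_module[of \<one>]] by simp_all
  obtain H' where H': "H' \<in> Arr C" "Dom C H' = M \<odot> T1" "Cod C H' = FObj T M"
      "H' \<cdot> ?H = Ident C (FObj T M)" "?H \<cdot> H' = Ident C (M \<odot> T1)"
    using H by (rule is_isoE) simp
  obtain H1' where H1': "H1' \<in> Arr C" "Dom C H1' = Cod C ?H1" "Cod C H1' = Dom C ?H1"
      "H1' \<cdot> ?H1 = Ident C (Dom C ?H1)"
    using H1 by (rule is_isoE)
  note [simp] = H'(1-3) H1'(1-3)
  \<comment> \<open>The candidate inverse, not yet factored through \<open>T(i)\<close>: the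
    coaction, read through the inverse of fusion.\<close>
  define g where "g = H' \<cdot> \<rho>"
  have g [simp]: "g \<in> Arr C" "Dom C g = M" "Cod C g = FObj T M"
    by (simp_all add: g_def)
  have Hg: "?H \<cdot> g = \<rho>"
    using arg_cong[OF H'(5), of "\<lambda>x. x \<cdot> \<rho>"] by (simp add: g_def)
  \<comment> \<open>That \<open>g\<close> equalizes the pair under \<open>T\<close> is checked after
    the invertible \<open>?H1\<close>, where it becomes coassociativity of
    \<open>\<rho>\<close>.\<close>
  have "?H1 \<cdot> (FArr T \<rho> \<cdot> g) = (\<rho> \<otimes> Ident C T1) \<cdot> (?H \<cdot> g)"
    using arg_cong[OF fusion_coaction[OF hm], of "\<lambda>x. x \<cdot> g"] by simp
  also have "\<dots> = (Ident C M \<otimes> T\<^sub>2\<^bsub>T\<^esub> \<one> \<one>) \<cdot> (?H \<cdot> g)"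
    by (simp add: Hg hopf_moduleD(5)[OF hm])
  also have "\<dots> = ?H1 \<cdot> (FArr T ?e \<cdot> g)"
    using arg_cong[OF fusion_unit[OF M], of "\<lambda>x. x \<cdot> g"] by simp
  finally have "(H1' \<cdot> ?H1) \<cdot> (FArr T \<rho> \<cdot> g) = (H1' \<cdot> ?H1) \<cdot> (FArr T ?e \<cdot> g)"
    by simp
  then have "FArr T \<rho> \<cdot> g = FArr T ?e \<cdot> g"
    unfolding H1'(4) by simp
  then obtain k where k: "k \<in> Arr C" "Dom C k = M" "Cod C k = FObj T (Dom C i)" "FArr T i \<cdot> k = g"
    using equalizerE[OF eq, of g] by auto
  \<comment> \<open>One side of invertibility is the counit law of the comodule, because
    \<open>r\<close> is fusion followed by the counit.\<close>
  have "(r \<cdot> FArr T i) \<cdot> k = r \<cdot> g"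
    using k by simp
  also have "\<dots> = ((Ident C M \<otimes> T\<^sub>0\<^bsub>T\<^esub>) \<cdot> ?H) \<cdot> g"
    by (simp add: counit_fusion[OF M])
  also have "\<dots> = Ident C M"
    by (simp add: Hg hopf_moduleD(6)[OF hm])
  finally have 1: "(r \<cdot> FArr T i) \<cdot> k = Ident C M" .
  \<comment> \<open>The other side is checked after \<open>T(i)\<close>, which is monic because it
    is an equalizer.\<close>
  have "FArr T i \<cdot> (k \<cdot> (r \<cdot> FArr T i)) = (FArr T i \<cdot> k) \<cdot> (r \<cdot> FArr T i)"
    using k(1-3) by simp
  also have "\<dots> = H' \<cdot> (\<rho> \<cdot> (r \<cdot> FArr T i))"
    by (simp add: k(4) g_def)
  also have "\<dots> = (H' \<cdot> ?H) \<cdot> FArr T i"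
    by (simp add: coaction_comparison[OF hm i])
  also have "\<dots> = FArr T i \<cdot> Ident C (FObj T (Dom C i))"
    by (simp add: H'(4))
  finally have 2: "k \<cdot> (r \<cdot> FArr T i) = Ident C (FObj T (Dom C i))"
    using k(1-3) by (auto intro: equalizer_mono[OF eq])
  show ?thesis
    using k(1-3) 1 2 by (intro is_isoI[where g = k]) simp_all
qed

section \<open>The category of Hopf modules and the free functor\<close>

abbreviation "HM \<equiv> right_hopf_modules C T"

abbreviation "Free \<equiv> free_hopf_module_functor C T"

lemma hopf_modules_obj: "(M, r, \<rho>) \<in> Obj HM \<longleftrightarrow> is_right_hopf_module C T M r \<rho>"
  by (simp add: right_hopf_modules_def)

lemma hopf_modules_arr:
  "((M, r, \<rho>), f, (N, s, \<sigma>)) \<in> Arr HM \<longleftrightarrow>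
    is_right_hopf_module C T M r \<rho> \<and> is_right_hopf_module C T N s \<sigma> \<and>
    f \<in> Arr C \<and> Dom C f = M \<and> Cod C f = N \<and> f \<cdot> r = s \<cdot> FArr T f \<and>
    \<sigma> \<cdot> f = (f \<otimes> Ident C T1) \<cdot> \<rho>"
  by (auto simp: right_hopf_modules_def is_right_hopf_module_hom_def hom_iff)

lemma hopf_modules_arr_obj: "(A, f, B) \<in> Arr HM \<Longrightarrow> A \<in> Obj HM \<and> B \<in> Obj HM"
  by (auto simp: right_hopf_modules_def)

lemma hopf_modules_arr_under:
  "(A, f, B) \<in> Arr HM \<Longrightarrow> f \<in> Arr C \<and> Dom C f = fst A \<and> Cod C f = fst B"
  by (cases A; cases B) (auto simp: hopf_modules_arr)

lemma hopf_modules_sel [simp]: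
  "Dom HM (A, f, B) = A" "Cod HM (A, f, B) = B" "Comp HM (A', g, B') (A, f, B) = (A, g \<cdot> f, B')"
  "Ident HM (M, r, \<rho>) = ((M, r, \<rho>), Ident C M, (M, r, \<rho>))"
  by (simp_all add: right_hopf_modules_def)

lemma hopf_modules_comp:
  assumes f: "(A, f, B) \<in> Arr HM" and g: "(B, g, E) \<in> Arr HM"
  shows "(A, g \<cdot> f, E) \<in> Arr HM"
proof -
  obtain M r \<rho> N s \<sigma> L t \<tau> where A: "A = (M, r, \<rho>)" "B = (N, s, \<sigma>)" "E = (L, t, \<tau>)"
    by (metis prod_cases3)
  note f = f[unfolded A hopf_modules_arr] and g = g[unfolded A hopf_modules_arr]
  have hm: "is_right_hopf_module C T M r \<rho>" "is_right_hopf_module C T N s \<sigma>" "is_right_hopf_module C T L t \<tau>"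
    using f g by auto
  note [simp] = hopf_moduleD(2-4)[OF hm(1)] moduleD[OF hopf_moduleD(1)[OF hm(1)]]
    hopf_moduleD(2-4)[OF hm(2)] moduleD[OF hopf_moduleD(1)[OF hm(2)]]
    hopf_moduleD(2-4)[OF hm(3)] moduleD[OF hopf_moduleD(1)[OF hm(3)]]
  have fa [simp]: "f \<in> Arr C" "Dom C f = M" "Cod C f = N" "g \<in> Arr C" "Dom C g = N" "Cod C g = L"
    using f g by auto
  have "(g \<cdot> f) \<cdot> r = (g \<cdot> s) \<cdot> FArr T f"
    using f by simp
  also have "\<dots> = t \<cdot> FArr T (g \<cdot> f)"
    using g by simp
  finally have 1: "(g \<cdot> f) \<cdot> r = t \<cdot> FArr T (g \<cdot> f)" .
  have "\<tau> \<cdot> (g \<cdot> f) = (\<tau> \<cdot> g) \<cdot> f"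
    by simp
  also have "\<dots> = (g \<otimes> Ident C T1) \<cdot> (\<sigma> \<cdot> f)"
    using g by simp
  also have "\<dots> = ((g \<cdot> f) \<otimes> Ident C T1) \<cdot> \<rho>"
    using f by simp
  finally show ?thesis
    using 1 hm by (simp add: A hopf_modules_arr)
qed

lemma hopf_modules_ident: "A \<in> Obj HM \<Longrightarrow> Ident HM A \<in> hom HM A A"
  by (cases A) (auto simp: hom_iff hopf_modules_obj hopf_modules_arr hopf_moduleD moduleD[OF hopf_moduleD(1)])

lemma category_hopf_modules: "category HM"
proof
  fix f assume "f \<in> Arr HM"
  then show "Dom HM f \<in> Obj HM" "Cod HM f \<in> Obj HM"
    by (auto simp: right_hopf_modules_def)
next
  fix A assume "A \<in> Obj HM" then show "Ident HM A \<in> hom HM A A" by (rule hopf_modules_ident)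
next
  fix f g A B E assume "f \<in> hom HM A B" "g \<in> hom HM B E"
  then show "Comp HM g f \<in> hom HM A E"
    by (cases f; cases g) (auto simp: hom_iff intro: hopf_modules_comp)
next
  fix f A B assume "f \<in> hom HM A B"
  then show "Comp HM f (Ident HM A) = f" "Comp HM (Ident HM B) f = f"
    by (cases f; cases A; cases B; auto simp: hom_iff hopf_modules_arr)+
next
  fix f g h A B E F assume "f \<in> hom HM A B" "g \<in> hom HM B E" "h \<in> hom HM E F"
  then show "Comp HM h (Comp HM g f) = Comp HM (Comp HM h g) f"
    by (cases f; cases g; cases h; cases A; cases B; cases E; cases F) (auto simp: hom_iff hopf_modules_arr)
qed

text \<open>The inverse in \<open>C\<close> is again linear and colinear: conjugating either square
  of \<open>f\<close> by its inverse \<open>g\<close> gives the corresponding square of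
  \<open>g\<close>.\<close>

lemma hopf_module_iso:
  assumes f: "(A, f, B) \<in> Arr HM" and iso: "is_iso C f"
  shows "is_iso HM (A, f, B)"
proof -
  interpret HM: category HM by (rule category_hopf_modules)
  obtain M r \<rho> N s \<sigma> where A: "A = (M, r, \<rho>)" "B = (N, s, \<sigma>)"
    by (metis prod_cases3)
  note f' = f[unfolded A hopf_modules_arr]
  have hm: "is_right_hopf_module C T M r \<rho>" "is_right_hopf_module C T N s \<sigma>"
    and fa [simp]: "f \<in> Arr C" "Dom C f = M" "Cod C f = N"
    using f' by auto
  note [simp] = hopf_moduleD(2-4)[OF hm(1)] moduleD[OF hopf_moduleD(1)[OF hm(1)]]
    hopf_moduleD(2-4)[OF hm(2)] moduleD[OF hopf_moduleD(1)[OF hm(2)]]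
  obtain g where ga [simp]: "g \<in> Arr C" "Dom C g = N" "Cod C g = M"
    and gf: "g \<cdot> f = Ident C M" and fg: "f \<cdot> g = Ident C N"
    using iso by (rule is_isoE) simp
  have "g \<cdot> s = g \<cdot> (s \<cdot> FArr T (f \<cdot> g))"
    by (simp add: fg del: map_comp_arr)
  also have "\<dots> = g \<cdot> ((s \<cdot> FArr T f) \<cdot> FArr T g)"
    by simp
  also have "\<dots> = g \<cdot> ((f \<cdot> r) \<cdot> FArr T g)"
    using f' by metis
  also have "\<dots> = (g \<cdot> f) \<cdot> (r \<cdot> FArr T g)"
    by simp
  finally have 1: "g \<cdot> s = r \<cdot> FArr T g"
    by (simp add: gf del: comp_assoc_arr)
  have "\<rho> \<cdot> g = ((g \<cdot> f) \<otimes> Ident C T1) \<cdot> (\<rho> \<cdot> g)"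
    by (simp add: gf)
  also have "\<dots> = (g \<otimes> Ident C T1) \<cdot> (((f \<otimes> Ident C T1) \<cdot> \<rho>) \<cdot> g)"
    by simp
  also have "\<dots> = (g \<otimes> Ident C T1) \<cdot> ((\<sigma> \<cdot> f) \<cdot> g)"
    using f' by metis
  also have "\<dots> = (g \<otimes> Ident C T1) \<cdot> \<sigma>"
    by (simp add: fg)
  finally have "(B, g, A) \<in> Arr HM"
    using 1 hm by (simp add: A hopf_modules_arr)
  then show ?thesis
    using f by (intro HM.is_isoI[where g = "(B, g, A)"]) (simp_all add: A gf fg)
qed

lemma free_sel [simp]:
  "FObj Free X = (FObj T X, Mu T X, T\<^sub>2\<^bsub>T\<^esub> X \<one>)"
  "FArr Free f = (FObj Free (Dom C f), FArr T f, FObj Free (Cod C f))"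
  by (simp_all add: free_hopf_module_functor_def Let_def)

text \<open>\<open>T(f)\<close> is linear by naturality of the multiplication and colinear by
  naturality of \<open>T\<^sub>2\<close> in its first argument.\<close>

lemma free_functor: "cat_functor C HM Free"
proof -
  interpret HM: category HM by (rule category_hopf_modules)
  show ?thesis
    by unfold_locales
      (auto simp: hom_iff hopf_modules_obj hopf_modules_arr free_hopf_module mu_natural cop_comodule_arr)
qed

end

section \<open>Invertibility of the fusion operators\<close>

context right_antipode
begin

section \<open>Modules and their right duals\<close>

lemma antipode_arr [simp]:
  assumes "X \<in> Obj C"
  shows "s X \<in> Arr C" "Dom C (s X) = FObj T (RDual C (FObj T X))" "Cod C (s X) = RDual C X"
  using antipode_hom[OF assms] by (auto simp: hom_iff)

lemma antipode_natural_arr: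
  assumes "f \<in> Arr C" "Dom C f = X" "Cod C f = Y"
  shows "s X \<cdot> FArr T (rdual_arr C (FArr T f)) = rdual_arr C f \<cdot> s Y"
  using antipode_natural[of f X Y] assms by (simp add: hom_iff)

text \<open>The action that the antipode puts on the right dual of a module. It serves to make
  evaluation and coevaluation linear for the tensor action, with \<open>T\<^sub>0\<close> as the
  action on the unit object.\<close>

definition dual_action :: "'o \<Rightarrow> 'm \<Rightarrow> 'm" where
  "dual_action M r = s M \<cdot> FArr T (rdual_arr C r)"

lemma dual_action_arr [simp]:
  assumes "is_module C T M r"
  shows "dual_action M r \<in> Arr C" "Dom C (dual_action M r) = FObj T (RDual C M)"
    "Cod C (dual_action M r) = RDual C M"
  by (simp_all add: dual_action_def moduleD[OF assms])

text \<open>Dinaturality moves the action \<open>r\<close> onto the dual side, where the evaluation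
  axiom of the antipode trades the multiplication for the unit; the unit then cancels
  \<open>r\<close>.\<close>

lemma rev_linear:
  assumes M: "is_module C T M r"
  shows "REv C M \<cdot> ((r \<otimes> dual_action M r) \<cdot> T\<^sub>2\<^bsub>T\<^esub> M (RDual C M)) = T\<^sub>0\<^bsub>T\<^esub> \<cdot> FArr T (REv C M)"
proof -
  note [simp] = moduleD[OF M]
  let ?I = "Ident C" and ?D = "RDual C M" and ?TM = "FObj T M" and ?a = "dual_action M r"
  let ?TD = "RDual C (FObj T M)"
  \<comment> \<open>Naturality of the antipode at \<open>r\<close> moves it past the dual of
    \<open>r\<close>; the dual of module associativity then produces the dual of the multiplication,
    as the antipode axiom requires.\<close>
  have r': "rdual_arr C r \<cdot> ?a = s ?TM \<cdot> FArr T (rdual_arr C (Mu T M)) \<cdot> FArr T (rdual_arr C r)"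
  proof -
    have "rdual_arr C r \<cdot> ?a = (rdual_arr C r \<cdot> s M) \<cdot> FArr T (rdual_arr C r)"
      by (simp add: dual_action_def)
    also have "\<dots> = s ?TM \<cdot> (FArr T (rdual_arr C (FArr T r) \<cdot> rdual_arr C r))"
      by (simp flip: antipode_natural_arr[of r ?TM M])
    also have "rdual_arr C (FArr T r) \<cdot> rdual_arr C r = rdual_arr C (Mu T M) \<cdot> rdual_arr C r"
      using module_assoc[OF M] by (simp flip: rdual_arr_comp)
    finally show ?thesis by simp
  qed
  have "REv C M \<cdot> ((r \<otimes> ?a) \<cdot> T\<^sub>2\<^bsub>T\<^esub> M ?D)
      = (REv C M \<cdot> (r \<otimes> ?I ?D)) \<cdot> ((?I ?TM \<otimes> ?a) \<cdot> T\<^sub>2\<^bsub>T\<^esub> M ?D)"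
    using M by simp
  also have "\<dots> = REv C ?TM \<cdot> ((?I ?TM \<otimes> (rdual_arr C r \<cdot> ?a)) \<cdot> T\<^sub>2\<^bsub>T\<^esub> M ?D)"
    using M by (simp flip: rev_rdual_arr)
  also have "\<dots> = REv C ?TM \<cdot> ((?I ?TM \<otimes> (s ?TM \<cdot> FArr T (rdual_arr C (Mu T M))))
      \<cdot> ((?I ?TM \<otimes> FArr T (rdual_arr C r)) \<cdot> T\<^sub>2\<^bsub>T\<^esub> M ?D))"
    by (simp add: r')
  also have "(?I ?TM \<otimes> FArr T (rdual_arr C r)) \<cdot> T\<^sub>2\<^bsub>T\<^esub> M ?D
      = T\<^sub>2\<^bsub>T\<^esub> M ?TD \<cdot> FArr T (?I M \<otimes> rdual_arr C r)"
    by (simp add: cop_natural_arr[of "?I M" M M "rdual_arr C r" ?D ?TD])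
  also have "REv C ?TM \<cdot> ((?I ?TM \<otimes> (s ?TM \<cdot> FArr T (rdual_arr C (Mu T M)))) \<cdot> \<dots>)
      = (REv C ?TM \<cdot> (?I ?TM \<otimes> (s ?TM \<cdot> FArr T (rdual_arr C (Mu T M)))) \<cdot> T\<^sub>2\<^bsub>T\<^esub> M ?TD)
        \<cdot> FArr T (?I M \<otimes> rdual_arr C r)"
    by simp
  also have "\<dots> = (T\<^sub>0\<^bsub>T\<^esub> \<cdot> FArr T (REv C M) \<cdot> FArr T (?I M \<otimes> rdual_arr C (Eta T M)))
      \<cdot> FArr T (?I M \<otimes> rdual_arr C r)"
    by (simp only: antipode_ev[OF moduleD(1)[OF M]])
  also have "\<dots> = T\<^sub>0\<^bsub>T\<^esub> \<cdot> (FArr T (REv C M) \<cdot> FArr T (?I M \<otimes> (rdual_arr C (Eta T M) \<cdot> rdual_arr C r)))"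
    by (simp flip: map_comp_arr)
  also have "rdual_arr C (Eta T M) \<cdot> rdual_arr C r = ?I ?D"
    by (simp add: module_unit[OF M] rdual_arr_ident flip: rdual_arr_comp)
  finally show ?thesis by simp
qed

text \<open>The coevaluation axiom of the antipode concerns \<open>T(M)\<close>; the unit law of the
  module brings it in, and dinaturality of coevaluation along \<open>r\<close> brings it down to
  \<open>M\<close>.\<close>

lemma rcoev_linear:
  assumes M: "is_module C T M r"
  shows "(dual_action M r \<otimes> r) \<cdot> (T\<^sub>2\<^bsub>T\<^esub> (RDual C M) M \<cdot> FArr T (RCoev C M)) = RCoev C M \<cdot> T\<^sub>0\<^bsub>T\<^esub>"
proof -
  note [simp] = moduleD[OF M]
  let ?I = "Ident C" and ?D = "RDual C M" and ?TM = "FObj T M" and ?TD = "RDual C (FObj T M)"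
  have "RCoev C M \<cdot> T\<^sub>0\<^bsub>T\<^esub> = (?I ?D \<otimes> r) \<cdot> ((?I ?D \<otimes> Eta T M) \<cdot> RCoev C M \<cdot> T\<^sub>0\<^bsub>T\<^esub>)"
    by (simp add: module_unit[OF M])
  also have "\<dots> = (?I ?D \<otimes> r) \<cdot> ((s M \<otimes> Mu T M) \<cdot> T\<^sub>2\<^bsub>T\<^esub> ?TD ?TM \<cdot> FArr T (RCoev C ?TM))"
    by (simp only: antipode_coev[OF moduleD(1)[OF M]])
  also have "\<dots> = (s M \<otimes> (r \<cdot> FArr T r)) \<cdot> (T\<^sub>2\<^bsub>T\<^esub> ?TD ?TM \<cdot> FArr T (RCoev C ?TM))"
    by (simp add: module_assoc[OF M])
  also have "\<dots> = (s M \<otimes> r) \<cdot> ((FArr T (?I ?TD) \<otimes> FArr T r) \<cdot> T\<^sub>2\<^bsub>T\<^esub> ?TD ?TM \<cdot> FArr T (RCoev C ?TM))"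
    by simp
  also have "\<dots> = (s M \<otimes> r) \<cdot> (T\<^sub>2\<^bsub>T\<^esub> ?TD M \<cdot> FArr T ((?I ?TD \<otimes> r) \<cdot> RCoev C ?TM))"
    by (simp add: cop_natural_comp[of _ ?TD ?TD _ ?TM])
  also have "(?I ?TD \<otimes> r) \<cdot> RCoev C ?TM = (rdual_arr C r \<otimes> ?I M) \<cdot> RCoev C M"
    by (simp add: rdual_arr_rcoev)
  also have "T\<^sub>2\<^bsub>T\<^esub> ?TD M \<cdot> FArr T \<dots> = (FArr T (rdual_arr C r) \<otimes> FArr T (?I M)) \<cdot> (T\<^sub>2\<^bsub>T\<^esub> ?D M \<cdot> FArr T (RCoev C M))"
    by (simp add: cop_natural_comp[of _ ?D ?TD _ M])
  also have "(s M \<otimes> r) \<cdot> \<dots> = (dual_action M r \<otimes> r) \<cdot> (T\<^sub>2\<^bsub>T\<^esub> ?D M \<cdot> FArr T (RCoev C M))"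
    by (simp add: dual_action_def)
  finally show ?thesis by simp
qed

text \<open>Coevaluation creates a copy of \<open>M\<close> and its dual inside \<open>T(Y)\<close>,
  \<open>T\<^sub>2\<close> splits the dual off, its action removes \<open>T\<close> from it, and
  evaluation pairs it with the outer \<open>M\<close>.\<close>

definition fusion_inv :: "'o \<Rightarrow> 'm \<Rightarrow> 'o \<Rightarrow> 'm" where
  "fusion_inv M r Y = (REv C M \<otimes> Ident C (FObj T (M \<odot> Y))) \<cdot> (Ident C M \<otimes>
     ((dual_action M r \<otimes> Ident C (FObj T (M \<odot> Y))) \<cdot>
       (T\<^sub>2\<^bsub>T\<^esub> (RDual C M) (M \<odot> Y) \<cdot> FArr T (RCoev C M \<otimes> Ident C Y))))"

lemma fusion_inv_arr [simp]:
  assumes "is_module C T M r" "Y \<in> Obj C"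
  shows "fusion_inv M r Y \<in> Arr C" "Dom C (fusion_inv M r Y) = M \<odot> FObj T Y"
    "Cod C (fusion_inv M r Y) = FObj T (M \<odot> Y)"
  using assms by (simp_all add: fusion_inv_def moduleD[OF assms(1)])

text \<open>Coassociativity gathers the actions on the dual and on \<open>M\<close>, linearity of
  coevaluation turns them into the counit, and a zigzag remains.\<close>

lemma fusion_fusion_inv:
  assumes M: "is_module C T M r" and Y [simp]: "Y \<in> Obj C"
  shows "fusion M r Y \<cdot> fusion_inv M r Y = Ident C (M \<odot> FObj T Y)"
proof -
  note [simp] = moduleD[OF M] M
  let ?I = "Ident C" and ?D = "RDual C M" and ?W = "FObj T (M \<odot> Y)" and ?a = "dual_action M r"
  let ?H = "fusion M r Y" and ?TY = "FObj T Y"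
  \<comment> \<open>The part of \<open>fusion_inv\<close> that precedes evaluation, without the
    outer factor \<open>M\<close>.\<close>
  define w where "w = (?a \<otimes> ?I ?W) \<cdot> (T\<^sub>2\<^bsub>T\<^esub> ?D (M \<odot> Y) \<cdot> FArr T (RCoev C M \<otimes> ?I Y))"
  have [simp]: "w \<in> Arr C" "Dom C w = ?TY" "Cod C w = ?D \<odot> ?W"
    by (simp_all add: w_def)
  have "(?I ?D \<otimes> ?H) \<cdot> w = (?a \<otimes> ?H) \<cdot> (T\<^sub>2\<^bsub>T\<^esub> ?D (M \<odot> Y) \<cdot> FArr T (RCoev C M \<otimes> ?I Y))"
    by (simp add: w_def)
  also have "\<dots> = (?a \<otimes> r \<otimes> ?I ?TY) \<cdot> (((?I (FObj T ?D) \<otimes> T\<^sub>2\<^bsub>T\<^esub> M Y) \<cdot> T\<^sub>2\<^bsub>T\<^esub> ?D (M \<odot> Y))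
      \<cdot> FArr T (RCoev C M \<otimes> ?I Y))"
    by (simp add: fusion_def)
  also have "\<dots> = ((?a \<otimes> r) \<otimes> ?I ?TY) \<cdot> ((T\<^sub>2\<^bsub>T\<^esub> ?D M \<otimes> ?I ?TY)
      \<cdot> (T\<^sub>2\<^bsub>T\<^esub> (?D \<odot> M) Y \<cdot> FArr T (RCoev C M \<otimes> ?I Y)))"
    unfolding cop_coassoc[OF rdual_obj[OF moduleD(1)[OF M]] moduleD(1)[OF M] Y] by simp
  also have "T\<^sub>2\<^bsub>T\<^esub> (?D \<odot> M) Y \<cdot> FArr T (RCoev C M \<otimes> ?I Y) = (FArr T (RCoev C M) \<otimes> ?I ?TY) \<cdot> T\<^sub>2\<^bsub>T\<^esub> \<one> Y"
    by (simp add: cop_natural_arr[of _ \<one> _ _ Y])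
  also have "((?a \<otimes> r) \<otimes> ?I ?TY) \<cdot> ((T\<^sub>2\<^bsub>T\<^esub> ?D M \<otimes> ?I ?TY) \<cdot> \<dots>)
      = (((?a \<otimes> r) \<cdot> (T\<^sub>2\<^bsub>T\<^esub> ?D M \<cdot> FArr T (RCoev C M))) \<otimes> ?I ?TY) \<cdot> T\<^sub>2\<^bsub>T\<^esub> \<one> Y"
    by (simp del: ten_arr_assoc)
  also have "\<dots> = (RCoev C M \<otimes> ?I ?TY) \<cdot> ((T\<^sub>0\<^bsub>T\<^esub> \<otimes> ?I ?TY) \<cdot> T\<^sub>2\<^bsub>T\<^esub> \<one> Y)"
    by (simp add: rcoev_linear)
  also have "\<dots> = RCoev C M \<otimes> ?I ?TY"
    by (simp add: cop_counit_left del: ten_comp_ten_comp)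
  finally have Hw: "(?I ?D \<otimes> ?H) \<cdot> w = RCoev C M \<otimes> ?I ?TY" .
  \<comment> \<open>Evaluation and fusion act on disjoint factors, so fusion can be applied to
    \<open>w\<close> first.\<close>
  have "?H \<cdot> fusion_inv M r Y = (?I \<one> \<otimes> ?H) \<cdot> ((REv C M \<otimes> ?I ?W) \<cdot> (?I M \<otimes> w))"
    by (simp add: fusion_inv_def w_def del: ten_comp_ten ten_comp_ten_comp)
  also have "\<dots> = (REv C M \<otimes> ?I (M \<odot> ?TY)) \<cdot> (((?I M \<otimes> ?I ?D) \<otimes> ?H) \<cdot> (?I M \<otimes> w))"
    by (simp del: unit_ten_arr)
  also have "\<dots> = ((REv C M \<otimes> ?I M) \<otimes> ?I ?TY) \<cdot> (?I M \<otimes> ((?I ?D \<otimes> ?H) \<cdot> w))"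
    by (simp del: ten_ident) (simp add: ten_ident)
  also have "\<dots> = ((REv C M \<otimes> ?I M) \<otimes> ?I ?TY) \<cdot> ((?I M \<otimes> RCoev C M) \<otimes> ?I ?TY)"
    by (simp add: Hw del: ten_comp_ten)
  also have "\<dots> = ((REv C M \<otimes> ?I M) \<cdot> (?I M \<otimes> RCoev C M)) \<otimes> ?I ?TY"
    by (simp del: ten_arr_assoc)
  finally show ?thesis by (simp add: rdual_zigzag1)
qed

text \<open>Here coassociativity gathers the actions on \<open>M\<close> and on the dual under
  evaluation. Linearity of evaluation moves it inside \<open>T\<close>, the counit law removes the
  coproduct, and the zigzag takes place under \<open>T\<close>.\<close>

lemma fusion_inv_fusion:
  assumes M: "is_module C T M r" and Y [simp]: "Y \<in> Obj C"
  shows "fusion_inv M r Y \<cdot> fusion M r Y = Ident C (FObj T (M \<odot> Y))"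
proof -
  note [simp] = moduleD[OF M] M
  let ?I = "Ident C" and ?D = "RDual C M" and ?N = "M \<odot> Y" and ?W = "FObj T (M \<odot> Y)"
  let ?a = "dual_action M r" and ?TM = "FObj T M"
  let ?c = "RCoev C M \<otimes> ?I Y"
  have "fusion_inv M r Y \<cdot> fusion M r Y = (REv C M \<otimes> ?I ?W) \<cdot> (((r \<otimes> ?a) \<otimes> ?I ?W) \<cdot>
      ((?I ?TM \<otimes> T\<^sub>2\<^bsub>T\<^esub> ?D ?N) \<cdot> ((FArr T (?I M) \<otimes> FArr T ?c) \<cdot> T\<^sub>2\<^bsub>T\<^esub> M Y)))"
    by (simp add: fusion_inv_def fusion_def)
  also have "(FArr T (?I M) \<otimes> FArr T ?c) \<cdot> T\<^sub>2\<^bsub>T\<^esub> M Y = T\<^sub>2\<^bsub>T\<^esub> M (?D \<odot> ?N) \<cdot> FArr T (?I M \<otimes> ?c)"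
    by (rule cop_natural_arr[symmetric]) simp_all
  also have "(?I ?TM \<otimes> T\<^sub>2\<^bsub>T\<^esub> ?D ?N) \<cdot> \<dots> = ((?I ?TM \<otimes> T\<^sub>2\<^bsub>T\<^esub> ?D ?N) \<cdot> T\<^sub>2\<^bsub>T\<^esub> M (?D \<odot> ?N)) \<cdot> FArr T (?I M \<otimes> ?c)"
    by simp
  also have "\<dots> = (T\<^sub>2\<^bsub>T\<^esub> M ?D \<otimes> ?I ?W) \<cdot> (T\<^sub>2\<^bsub>T\<^esub> (M \<odot> ?D) ?N \<cdot> FArr T (?I M \<otimes> ?c))"
    by (simp add: cop_coassoc)
  also have "(REv C M \<otimes> ?I ?W) \<cdot> (((r \<otimes> ?a) \<otimes> ?I ?W) \<cdot> \<dots>)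
      = ((REv C M \<cdot> ((r \<otimes> ?a) \<cdot> T\<^sub>2\<^bsub>T\<^esub> M ?D)) \<otimes> ?I ?W) \<cdot> (T\<^sub>2\<^bsub>T\<^esub> (M \<odot> ?D) ?N \<cdot> FArr T (?I M \<otimes> ?c))"
    by (simp del: ten_arr_assoc)
  also have "\<dots> = (T\<^sub>0\<^bsub>T\<^esub> \<otimes> ?I ?W) \<cdot> ((FArr T (REv C M) \<otimes> FArr T (?I ?N)) \<cdot> T\<^sub>2\<^bsub>T\<^esub> (M \<odot> ?D) ?N \<cdot> FArr T (?I M \<otimes> ?c))"
    by (simp add: rev_linear)
  also have "(FArr T (REv C M) \<otimes> FArr T (?I ?N)) \<cdot> T\<^sub>2\<^bsub>T\<^esub> (M \<odot> ?D) ?N = T\<^sub>2\<^bsub>T\<^esub> \<one> ?N \<cdot> FArr T (REv C M \<otimes> ?I ?N)"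
    by (rule cop_natural_arr[symmetric]) simp_all
  also have "(T\<^sub>0\<^bsub>T\<^esub> \<otimes> ?I ?W) \<cdot> (\<dots> \<cdot> FArr T (?I M \<otimes> ?c))
      = ((T\<^sub>0\<^bsub>T\<^esub> \<otimes> ?I ?W) \<cdot> T\<^sub>2\<^bsub>T\<^esub> \<one> ?N) \<cdot> FArr T ((REv C M \<otimes> ?I ?N) \<cdot> (?I M \<otimes> ?c))"
    by (simp del: ten_comp_ten ten_comp_ten_comp)
  also have "\<dots> = FArr T ((REv C M \<otimes> ?I ?N) \<cdot> (?I M \<otimes> ?c))"
    by (simp add: cop_counit_left del: comp_assoc_arr map_comp_arr)
  also have "(REv C M \<otimes> ?I ?N) \<cdot> (?I M \<otimes> ?c) = ((REv C M \<otimes> ?I M) \<otimes> ?I Y) \<cdot> ((?I M \<otimes> RCoev C M) \<otimes> ?I Y)"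
    by (simp del: ten_comp_ten)
  also have "\<dots> = ((REv C M \<otimes> ?I M) \<cdot> (?I M \<otimes> RCoev C M)) \<otimes> ?I Y"
    by (simp del: ten_arr_assoc)
  finally show ?thesis by (simp add: rdual_zigzag1)
qed

lemma fusion_is_iso:
  assumes "is_module C T M r" "Y \<in> Obj C"
  shows "is_iso C (fusion M r Y)"
  using assms moduleD[OF assms(1)]
  by (intro is_isoI[where g = "fusion_inv M r Y"]) (simp_all add: fusion_fusion_inv fusion_inv_fusion)

end

section \<open>The equivalence\<close>

locale right_antipode_with_coinvariants = right_antipode C T s
  for C :: "('o, 'm, 'x) right_autonomous_category_scheme" (structure)
    and T :: "('o, 'm, 'z) bimonad_scheme" and s +
  assumes admit: "is_right_hopf_module C T M r \<rho> \<Longrightarrow> admits_coinvariants C T M \<rho>"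
    and preserved: "is_right_hopf_module C T M r \<rho> \<Longrightarrow> coinvariants_preserved C T M \<rho>"
begin

section \<open>The coinvariants functor\<close>

definition coinv :: "'o \<times> 'm \<times> 'm \<Rightarrow> 'm" where
  "coinv = (\<lambda>(M, r, \<rho>). SOME i. is_coinvariants C T M \<rho> i)"

lemma coinv_coinvariants:
  assumes "is_right_hopf_module C T M r \<rho>"
  shows "is_coinvariants C T M \<rho> (coinv (M, r, \<rho>))"
  using admit[OF assms] unfolding admits_coinvariants_def coinv_def by (simp add: someI_ex)

lemma coinv_arr [simp]:
  assumes "A \<in> Obj HM"
  shows "coinv A \<in> Arr C" "Cod C (coinv A) = fst A"
  using assms coinvariantsD(1,2)[OF coinv_coinvariants] by (cases A; auto simp: hopf_modules_obj)+

lemma coinv_mono: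
  assumes "A \<in> Obj HM" "h \<in> Arr C" "k \<in> Arr C" "Cod C h = Dom C (coinv A)" "Cod C k = Dom C (coinv A)"
    and "coinv A \<cdot> h = coinv A \<cdot> k"
  shows "h = k"
proof -
  obtain M r \<rho> where A: "A = (M, r, \<rho>)" by (cases A)
  have "is_coinvariants C T M \<rho> (coinv A)"
    using assms(1) unfolding A by (intro coinv_coinvariants) (simp add: hopf_modules_obj)
  then show ?thesis
    using assms unfolding is_coinvariants_def by (auto intro: equalizer_mono)
qed

text \<open>The factorization of \<open>h\<close> through the coinvariants; meaningful when
  \<open>h\<close> equalizes the coaction and the trivial coaction by the unit, as in lemma
  \<open>factor\<close>.\<close>

definition factor :: "'o \<times> 'm \<times> 'm \<Rightarrow> 'm \<Rightarrow> 'm" where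
  "factor A h = (SOME k. k \<in> Arr C \<and> Dom C k = Dom C h \<and> Cod C k = Dom C (coinv A) \<and> coinv A \<cdot> k = h)"

lemma factor:
  assumes hm: "is_right_hopf_module C T M r \<rho>" and h: "h \<in> Arr C" "Cod C h = M"
    and eq: "\<rho> \<cdot> h = (Ident C M \<otimes> Eta T \<one>) \<cdot> h"
  shows "factor (M, r, \<rho>) h \<in> Arr C" "Dom C (factor (M, r, \<rho>) h) = Dom C h"
    "Cod C (factor (M, r, \<rho>) h) = Dom C (coinv (M, r, \<rho>))"
    "coinv (M, r, \<rho>) \<cdot> factor (M, r, \<rho>) h = h"
proof -
  have "is_equalizer C \<rho> (Ident C M \<otimes> Eta T \<one>) (coinv (M, r, \<rho>))"
    using coinv_coinvariants[OF hm] by (simp add: is_coinvariants_def)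
  then obtain k where "k \<in> Arr C" "Dom C k = Dom C h" "Cod C k = Dom C (coinv (M, r, \<rho>))"
      "coinv (M, r, \<rho>) \<cdot> k = h"
    using h eq hopf_moduleD(3)[OF hm] by (auto elim: equalizerE)
  then have "\<exists>k. k \<in> Arr C \<and> Dom C k = Dom C h \<and> Cod C k = Dom C (coinv (M, r, \<rho>)) \<and> coinv (M, r, \<rho>) \<cdot> k = h"
    by blast
  from someI_ex[OF this] show "factor (M, r, \<rho>) h \<in> Arr C" "Dom C (factor (M, r, \<rho>) h) = Dom C h"
    "Cod C (factor (M, r, \<rho>) h) = Dom C (coinv (M, r, \<rho>))"
    "coinv (M, r, \<rho>) \<cdot> factor (M, r, \<rho>) h = h"
    by (auto simp: factor_def)
qed

definition coinv_functor :: "('o \<times> 'm \<times> 'm, ('o \<times> 'm \<times> 'm) \<times> 'm \<times> ('o \<times> 'm \<times> 'm), 'o, 'm) functor_data" where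
  "coinv_functor = \<lparr>FObj = (\<lambda>A. Dom C (coinv A)), FArr = (\<lambda>(A, f, B). factor B (f \<cdot> coinv A))\<rparr>"

lemma coinv_functor_obj [simp]: "FObj coinv_functor A = Dom C (coinv A)"
  by (simp add: coinv_functor_def)

text \<open>A colinear map carries coinvariants to coinvariants, so \<open>f \<cdot> coinv A\<close>
  factors through \<open>coinv B\<close>. The last equation characterizes the induced arrow because
  \<open>coinv B\<close> is monic.\<close>

lemma coinv_functor_arr:
  assumes f: "(A, f, B) \<in> Arr HM"
  shows "FArr coinv_functor (A, f, B) \<in> Arr C"
    "Dom C (FArr coinv_functor (A, f, B)) = Dom C (coinv A)"
    "Cod C (FArr coinv_functor (A, f, B)) = Dom C (coinv B)"
    "coinv B \<cdot> FArr coinv_functor (A, f, B) = f \<cdot> coinv A"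
proof -
  obtain M r \<rho> N u \<sigma> where A: "A = (M, r, \<rho>)" "B = (N, u, \<sigma>)"
    by (metis prod_cases3)
  note f' = f[unfolded A hopf_modules_arr]
  have hm: "is_right_hopf_module C T M r \<rho>" "is_right_hopf_module C T N u \<sigma>"
    and [simp]: "f \<in> Arr C" "Dom C f = M" "Cod C f = N"
    and col: "\<sigma> \<cdot> f = (f \<otimes> Ident C T1) \<cdot> \<rho>"
    using f' by auto
  note [simp] = hopf_moduleD(2-4)[OF hm(1)] moduleD[OF hopf_moduleD(1)[OF hm(1)]]
    hopf_moduleD(2-4)[OF hm(2)] moduleD[OF hopf_moduleD(1)[OF hm(2)]]
  note i = coinvariantsD[OF coinv_coinvariants[OF hm(1)] hm(1), folded A]
  have "\<sigma> \<cdot> (f \<cdot> coinv A) = (\<sigma> \<cdot> f) \<cdot> coinv A"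
    using i(1,2) by simp
  also have "\<dots> = (f \<otimes> Ident C T1) \<cdot> (\<rho> \<cdot> coinv A)"
    using i(1,2) by (simp add: col)
  also have "\<dots> = (Ident C N \<otimes> Eta T \<one>) \<cdot> ((f \<otimes> Ident C \<one>) \<cdot> coinv A)"
    unfolding i(3) using i(1,2) by (simp del: ten_unit_arr)
  finally have eq: "\<sigma> \<cdot> (f \<cdot> coinv A) = (Ident C N \<otimes> Eta T \<one>) \<cdot> (f \<cdot> coinv A)"
    using i(1,2) by (simp del: ten_comp_ten_comp)
  show "FArr coinv_functor (A, f, B) \<in> Arr C"
    "Dom C (FArr coinv_functor (A, f, B)) = Dom C (coinv A)"
    "Cod C (FArr coinv_functor (A, f, B)) = Dom C (coinv B)"
    "coinv B \<cdot> FArr coinv_functor (A, f, B) = f \<cdot> coinv A"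
    using factor[OF hm(2) _ _ eq] i(1,2) by (simp_all add: coinv_functor_def A)
qed

lemma coinv_functor: "cat_functor HM C coinv_functor"
proof -
  interpret HM: category HM by (rule category_hopf_modules)
  show ?thesis
  proof unfold_locales
    fix A assume A: "A \<in> Obj HM"
    then show "FObj coinv_functor A \<in> Obj C"
      by simp
    obtain M r \<rho> where A': "A = (M, r, \<rho>)" by (cases A)
    have id: "Ident HM A = (A, Ident C (fst A), A)" "(A, Ident C (fst A), A) \<in> Arr HM"
      using hopf_modules_ident[OF A] by (auto simp: A' hom_iff)
    note g = coinv_functor_arr[OF id(2)]
    show "FArr coinv_functor (Ident HM A) = Ident C (FObj coinv_functor A)"
      unfolding id(1) using A g coinv_arr[OF A]
      by - (rule coinv_mono[OF A], simp_all del: coinv_arr)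
  next
    fix f A B assume "f \<in> hom HM A B"
    then obtain f' where f: "f = (A, f', B)" "(A, f', B) \<in> Arr HM"
      by (cases f) (auto simp: hom_iff)
    then show "FArr coinv_functor f \<in> hom C (FObj coinv_functor A) (FObj coinv_functor B)"
      using coinv_functor_arr(1-3)[OF f(2)] by (simp add: hom_iff)
  next
    fix f g A B E assume "f \<in> hom HM A B" "g \<in> hom HM B E"
    then obtain f' g' where f: "f = (A, f', B)" "(A, f', B) \<in> Arr HM" and g: "g = (B, g', E)" "(B, g', E) \<in> Arr HM"
      by (cases f; cases g) (auto simp: hom_iff)
    note gf = hopf_modules_comp[OF f(2) g(2)]
    note F = coinv_functor_arr[OF f(2)] and G = coinv_functor_arr[OF g(2)] and GF = coinv_functor_arr[OF gf]
    note obj = hopf_modules_arr_obj[OF f(2)] hopf_modules_arr_obj[OF g(2)]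
    note under = hopf_modules_arr_under[OF f(2)] hopf_modules_arr_under[OF g(2)]
    \<comment> \<open>The composition law is verified after the monic
      \<open>coinv E\<close>.\<close>
    have "coinv E \<cdot> (FArr coinv_functor g \<cdot> FArr coinv_functor f)
        = (coinv E \<cdot> FArr coinv_functor g) \<cdot> FArr coinv_functor f"
      using obj F(1-3) G(1-3) by (simp add: f g)
    also have "\<dots> = g' \<cdot> (coinv B \<cdot> FArr coinv_functor f)"
      using obj under F(1-3) G by (simp add: f g)
    also have "\<dots> = coinv E \<cdot> FArr coinv_functor (A, g' \<cdot> f', E)"
      using obj under by (simp add: f F(4) GF(4))
    finally have "FArr coinv_functor g \<cdot> FArr coinv_functor f = FArr coinv_functor (A, g' \<cdot> f', E)"
      using obj F(1-3) G(1-3) GF(1-3) by - (rule coinv_mono[of E], simp_all add: f g)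
    then show "FArr coinv_functor (Comp HM g f) = FArr coinv_functor g \<cdot> FArr coinv_functor f"
      by (simp add: f g)
  qed
qed

section \<open>The counit of the adjunction\<close>

definition comparison :: "'o \<times> 'm \<times> 'm \<Rightarrow> ('o \<times> 'm \<times> 'm) \<times> 'm \<times> ('o \<times> 'm \<times> 'm)" where
  "comparison = (\<lambda>(M, r, \<rho>). (FObj Free (Dom C (coinv (M, r, \<rho>))), r \<cdot> FArr T (coinv (M, r, \<rho>)), (M, r, \<rho>)))"

text \<open>The antipode makes both fusion operators in \<open>comparison_is_iso\<close> invertible,
  the second because the tensor product with the free module on the unit object is again a
  module.\<close>

lemma comparison_iso:
  assumes hm: "is_right_hopf_module C T M r \<rho>"
  shows "is_iso C (r \<cdot> FArr T (coinv (M, r, \<rho>)))"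
proof (rule comparison_is_iso[OF hm coinv_coinvariants[OF hm]])
  note M = hopf_moduleD(1)[OF hm]
  show "is_equalizer C (FArr T \<rho>) (FArr T (Ident C M \<otimes> Eta T \<one>)) (FArr T (coinv (M, r, \<rho>)))"
    using preserved[OF hm] coinv_coinvariants[OF hm] by (simp add: coinvariants_preserved_def)
  show "is_iso C (fusion M r \<one>)"
    by (rule fusion_is_iso[OF M unit_obj])
  show "is_iso C (fusion (M \<odot> T1) (tensor_action M r T1 (Mu T \<one>)) \<one>)"
    by (rule fusion_is_iso[OF tensor_module[OF M free_module[OF unit_obj]] unit_obj])
qed

lemma comparison_arr:
  assumes hm: "is_right_hopf_module C T M r \<rho>"
  shows "comparison (M, r, \<rho>) \<in> Arr HM"
proof -
  have M: "is_module C T M r" using hm by (rule hopf_moduleD)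
  note i = coinv_coinvariants[OF hm]
  note [simp] = hopf_moduleD(2-4)[OF hm] moduleD[OF M] coinvariantsD(1,2)[OF i hm]
  let ?i = "coinv (M, r, \<rho>)" and ?N = "Dom C (coinv (M, r, \<rho>))"
  have "(r \<cdot> FArr T ?i) \<cdot> Mu T ?N = r \<cdot> (Mu T M \<cdot> FArr T (FArr T ?i))"
    by (simp add: mu_natural[of _ ?N M])
  also have "\<dots> = (r \<cdot> FArr T r) \<cdot> FArr T (FArr T ?i)"
    by (simp add: module_assoc[OF M])
  finally have lin: "(r \<cdot> FArr T ?i) \<cdot> Mu T ?N = r \<cdot> FArr T (r \<cdot> FArr T ?i)"
    by simp
  have "\<rho> \<cdot> (r \<cdot> FArr T ?i) = (r \<otimes> Ident C T1) \<cdot> (T\<^sub>2\<^bsub>T\<^esub> M \<one> \<cdot> FArr T ?i)"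
    by (simp add: coaction_comparison[OF hm i] fusion_def)
  also have "\<dots> = ((r \<cdot> FArr T ?i) \<otimes> Ident C T1) \<cdot> T\<^sub>2\<^bsub>T\<^esub> ?N \<one>"
    by (simp add: cop_comodule_arr[of _ ?N M])
  finally show ?thesis
    using lin hm by (simp add: comparison_def hopf_modules_arr free_hopf_module)
qed

lemma comparison_nat_iso: "nat_iso HM HM (comp_functor Free coinv_functor) id_functor comparison"
proof -
  interpret HM: category HM by (rule category_hopf_modules)
  interpret G: cat_functor HM C coinv_functor by (rule coinv_functor)
  have sel: "Dom HM (comparison A) = FObj Free (Dom C (coinv A))" "Cod HM (comparison A) = A" for A
    by (cases A, simp add: comparison_def)+
  have "nat_trans HM HM (comp_functor Free coinv_functor) id_functor comparison"
  proof (intro nat_trans.intro nat_trans_axioms.intro)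
    show "cat_functor HM HM (comp_functor Free coinv_functor)"
      by (rule cat_functor_comp[OF coinv_functor free_functor])
    show "cat_functor HM HM id_functor"
      by (rule cat_functor_id[OF category_hopf_modules])
  next
    fix A assume A: "A \<in> Obj HM"
    then have "comparison A \<in> Arr HM"
      by (cases A) (auto simp: hopf_modules_obj comparison_arr)
    then show "comparison A \<in> hom HM (FObj (comp_functor Free coinv_functor) A) (FObj id_functor A)"
      by (simp add: hom_iff sel comp_functor_def id_functor_def)
  next
    fix f A B assume "f \<in> hom HM A B"
    then obtain f' where f: "f = (A, f', B)" "(A, f', B) \<in> Arr HM"
      by (cases f) (auto simp: hom_iff)
    obtain M r \<rho> N u \<sigma> where A: "A = (M, r, \<rho>)" "B = (N, u, \<sigma>)"
      by (metis prod_cases3)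
    note f' = f(2)[unfolded A hopf_modules_arr]
    have hm: "is_right_hopf_module C T M r \<rho>" "is_right_hopf_module C T N u \<sigma>"
      and [simp]: "f' \<in> Arr C" "Dom C f' = M" "Cod C f' = N"
      and lin: "f' \<cdot> r = u \<cdot> FArr T f'"
      using f' by auto
    note [simp] = hopf_moduleD(2-4)[OF hm(1)] moduleD[OF hopf_moduleD(1)[OF hm(1)]]
      hopf_moduleD(2-4)[OF hm(2)] moduleD[OF hopf_moduleD(1)[OF hm(2)]]
      coinvariantsD(1,2)[OF coinv_coinvariants[OF hm(1)] hm(1)]
      coinvariantsD(1,2)[OF coinv_coinvariants[OF hm(2)] hm(2)]
    note Gf = coinv_functor_arr[OF f(2), unfolded A]
    let ?G = "FArr coinv_functor ((M, r, \<rho>), f', (N, u, \<sigma>))"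
    \<comment> \<open>Naturality on underlying arrows: the characteristic equation of the induced
      arrow under \<open>T\<close>, then linearity of \<open>f'\<close>.\<close>
    have "(u \<cdot> FArr T (coinv (N, u, \<sigma>))) \<cdot> FArr T ?G = u \<cdot> FArr T (coinv (N, u, \<sigma>) \<cdot> ?G)"
      using Gf(1-3) by simp
    also have "\<dots> = (u \<cdot> FArr T f') \<cdot> FArr T (coinv (M, r, \<rho>))"
      by (simp add: Gf(4))
    also have "\<dots> = f' \<cdot> (r \<cdot> FArr T (coinv (M, r, \<rho>)))"
      by (simp flip: lin)
    finally show "Comp HM (comparison B) (FArr (comp_functor Free coinv_functor) f)
        = Comp HM (FArr id_functor f) (comparison A)"
      using Gf(1-3) by (simp add: f A comparison_def comp_functor_def id_functor_def)
  qed
  moreover have "is_iso HM (comparison A)" if "A \<in> Obj HM" for A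
  proof (cases A)
    case (fields M r \<rho>)
    then have "is_right_hopf_module C T M r \<rho>"
      using that by (simp add: hopf_modules_obj)
    then show ?thesis
      unfolding fields using comparison_iso comparison_arr
      by (simp add: comparison_def hopf_module_iso)
  qed
  ultimately show ?thesis by (simp add: nat_iso_def)
qed

section \<open>The unit of the adjunction\<close>

definition unit_factor :: "'o \<Rightarrow> 'm" where
  "unit_factor X = factor (FObj Free X) (Eta T X)"

text \<open>Compatibility of \<open>T\<^sub>2\<close> with the unit says that \<open>Eta T X\<close>
  is coinvariant in the free Hopf module on \<open>X\<close>, so it factors through the
  coinvariants.\<close>

lemma unit_factor:
  assumes X [simp]: "X \<in> Obj C"
  shows "unit_factor X \<in> Arr C" "Dom C (unit_factor X) = X"
    "Cod C (unit_factor X) = Dom C (coinv (FObj Free X))"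
    "coinv (FObj Free X) \<cdot> unit_factor X = Eta T X"
proof -
  have "T\<^sub>2\<^bsub>T\<^esub> X \<one> \<cdot> Eta T X = Eta T X \<otimes> Eta T \<one>"
    using cop_eta[of X \<one>] by simp
  also have "\<dots> = (Ident C (FObj T X) \<otimes> Eta T \<one>) \<cdot> (Eta T X \<otimes> Ident C \<one>)"
    by (simp del: ten_unit_arr)
  finally have eq: "T\<^sub>2\<^bsub>T\<^esub> X \<one> \<cdot> Eta T X = (Ident C (FObj T X) \<otimes> Eta T \<one>) \<cdot> Eta T X"
    by (simp del: ten_comp_ten)
  note k = factor[OF free_hopf_module[OF X] _ _ eq]
  show "unit_factor X \<in> Arr C" "Dom C (unit_factor X) = X"
    "Cod C (unit_factor X) = Dom C (coinv (FObj Free X))"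
    "coinv (FObj Free X) \<cdot> unit_factor X = Eta T X"
    using k by (simp_all add: unit_factor_def)
qed

text \<open>By the triangle identity, the comparison at the free Hopf module composed with
  \<open>T(unit_factor X)\<close> is the identity. The comparison is invertible, hence so is the
  other factor.\<close>

lemma map_unit_factor_iso:
  assumes X [simp]: "X \<in> Obj C"
  shows "is_iso C (FArr T (unit_factor X))"
proof -
  let ?i = "coinv (FObj Free X)"
  note u = unit_factor[OF X]
  have i: "?i \<in> Arr C" "Cod C ?i = FObj T X"
    using coinvariantsD(1,2)[OF coinv_coinvariants free_hopf_module] free_hopf_module[OF X] by auto
  have "(Mu T X \<cdot> FArr T ?i) \<cdot> FArr T (unit_factor X) = Mu T X \<cdot> FArr T (?i \<cdot> unit_factor X)"
    using u(1-3) i by (simp del: free_sel)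
  also have "\<dots> = Ident C (FObj T X)"
    by (simp add: u(4) mu_map_eta del: free_sel)
  finally have "(Mu T X \<cdot> FArr T ?i) \<cdot> FArr T (unit_factor X) = Ident C (FObj T X)" .
  moreover have "is_iso C (Ident C (FObj T X))"
    by (rule is_isoI[where g = "Ident C (FObj T X)"]) simp_all
  moreover have "is_iso C (Mu T X \<cdot> FArr T ?i)"
    using comparison_iso[OF free_hopf_module[OF X]] by simp
  ultimately show ?thesis
    using is_iso_cancel_left[of "Mu T X \<cdot> FArr T ?i" "FArr T (unit_factor X)"] u(1-3) i
    by (simp del: free_sel comp_assoc_arr)
qed

lemma unit_factor_nat_iso:
  assumes "conservative C C T"
  shows "nat_iso C C id_functor (comp_functor coinv_functor Free) unit_factor"
proof -
  interpret HM: category HM by (rule category_hopf_modules)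
  interpret F: cat_functor C HM Free by (rule free_functor)
  have "nat_trans C C id_functor (comp_functor coinv_functor Free) unit_factor"
  proof (intro nat_trans.intro nat_trans_axioms.intro)
    show "cat_functor C C (comp_functor coinv_functor Free)"
      by (rule cat_functor_comp[OF free_functor coinv_functor])
    show "cat_functor C C id_functor"
      by (rule cat_functor_id) unfold_locales
  next
    fix X assume "X \<in> Obj C"
    then show "unit_factor X \<in> hom C (FObj id_functor X) (FObj (comp_functor coinv_functor Free) X)"
      using unit_factor[of X] by (simp add: hom_iff id_functor_def comp_functor_def)
  next
    fix f X Y assume "f \<in> hom C X Y"
    then have f [simp]: "f \<in> Arr C" "Dom C f = X" "Cod C f = Y" and [simp]: "X \<in> Obj C" "Y \<in> Obj C"
      by (auto simp: hom_iff)
    let ?Ff = "(FObj Free X, FArr T f, FObj Free Y)"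
    let ?i = "coinv (FObj Free X)" and ?j = "coinv (FObj Free Y)"
    have Ff: "?Ff \<in> Arr HM"
      using F.map_arr(1)[of f] by simp
    note Gf = coinv_functor_arr[OF Ff] and u = unit_factor[of X] and v = unit_factor[of Y]
    have obj: "FObj Free X \<in> Obj HM" "FObj Free Y \<in> Obj HM"
      using F.map_obj by simp_all
    have ij [simp]: "?i \<in> Arr C" "?j \<in> Arr C" "Cod C ?i = FObj T X" "Cod C ?j = FObj T Y"
      using coinv_arr[OF obj(1)] coinv_arr[OF obj(2)] by simp_all
    note [simp del] = free_sel
    note [simp] = Gf(1-3) u(1-3) v(1-3)
    \<comment> \<open>After the monic \<open>?j\<close>, naturality of the factored unit reduces to
      naturality of \<open>Eta T\<close>.\<close>
    have "?j \<cdot> (unit_factor Y \<cdot> f) = (?j \<cdot> unit_factor Y) \<cdot> f"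
      by simp
    also have "\<dots> = FArr T f \<cdot> (?i \<cdot> unit_factor X)"
      by (simp add: u(4) v(4) eta_natural)
    also have "\<dots> = (?j \<cdot> FArr coinv_functor ?Ff) \<cdot> unit_factor X"
      by (simp add: Gf(4))
    finally have "?j \<cdot> (unit_factor Y \<cdot> f) = ?j \<cdot> (FArr coinv_functor ?Ff \<cdot> unit_factor X)"
      by simp
    then have "unit_factor Y \<cdot> f = FArr coinv_functor ?Ff \<cdot> unit_factor X"
      by (rule coinv_mono[OF obj(2), rotated 4]) simp_all
    then show "unit_factor Y \<cdot> FArr id_functor f = FArr (comp_functor coinv_functor Free) f \<cdot> unit_factor X"
      by (simp add: id_functor_def comp_functor_def free_sel(2))
  qed
  moreover have "is_iso C (unit_factor X)" if "X \<in> Obj C" for X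
    using assms map_unit_factor_iso[OF that] unit_factor(1)[OF that] by (simp add: conservative_def)
  ultimately show ?thesis by (simp add: nat_iso_def)
qed

text \<open>If \<open>T(f)\<close> is invertible in \<open>C\<close>, then \<open>Free\<close> sends
  \<open>f\<close> to an isomorphism of Hopf modules, which an equivalence reflects. Conversely,
  conservativity makes the unit invertible, while the counit is already an isomorphism.\<close>

lemma equivalence_iff_conservative: "is_equivalence C HM Free \<longleftrightarrow> conservative C C T"
proof
  interpret F: cat_functor C HM Free by (rule free_functor)
  assume "is_equivalence C HM Free"
  then have refl: "conservative C HM Free"
    by (rule equivalence_conservative)
  show "conservative C C T"
    unfolding conservative_def
  proof (intro ballI impI)
    fix f assume f: "f \<in> Arr C" and "is_iso C (FArr T f)"
    then have "is_iso HM (FArr Free f)"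
      using F.map_arr(1)[OF f] by (simp add: hopf_module_iso)
    then show "is_iso C f"
      using refl f by (simp add: conservative_def)
  qed
next
  assume "conservative C C T"
  then show "is_equivalence C HM Free"
    unfolding is_equivalence_def
    using free_functor coinv_functor comparison_nat_iso unit_factor_nat_iso by blast
qed

end

theorem theorem4p6:
  fixes C :: "('o, 'm) right_autonomous_category"
    and T :: "('o, 'm) bimonad"
  assumes hopf: "right_hopf_monad C T"
    and admit: "\<And>M r \<rho>. is_right_hopf_module C T M r \<rho> \<Longrightarrow> admits_coinvariants C T M \<rho>"
    and preserved: "\<And>M r \<rho>. is_right_hopf_module C T M r \<rho> \<Longrightarrow> coinvariants_preserved C T M \<rho>"
  shows "cat_functor C (right_hopf_modules C T) (free_hopf_module_functor C T)
    \<and> (is_equivalence C (right_hopf_modules C T) (free_hopf_module_functor C T)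
        \<longleftrightarrow> conservative C C T)"
proof -
  obtain s where "right_antipode C T s"
    using hopf by (auto simp: right_hopf_monad_def)
  then interpret right_antipode_with_coinvariants C T s
    using admit preserved
    by (intro right_antipode_with_coinvariants.intro right_antipode_with_coinvariants_axioms.intro)
  show ?thesis
    using free_functor equivalence_iff_conservative by blast
qed

end
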